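(* Let $V(S,M)$ be the $\mathrm{Sp}(4,\mathbb{Z})$-invariant F-term scalar potential defined in the context, with dilaton Kähler potential $$k(S,\bar S)=-\ln(S+\bar S).$$ Let $(S_0,M_0)$ be a point with $M_0\in\{\sigma_1,\dots,\sigma_6\}$ one of the elliptic fixed points of $\mathrm{Sp}(4,\mathbb{Z})$. Then the following three conditions cannot hold simultaneously: (i) $V(S_0,M_0)>0$; (ii) $\partial_SV(S_0,M_0)=0$; (iii) all eigenvalues of the Hessian of $V$ (with respect to the real and imaginary parts of the scalar fields $S,T,U,Z$) at $(S_0,M_0)$ are $\ge 0$.
   Context: $\mathbb{H}_2=\{M=\begin{pmatrix}T&Z\\Z&U\end{pmatrix}\in \mathrm{Mat}(2\times2,\mathbb{C}) : \mathrm{Im}\,M>0\}$ is the Siegel upper half-space of genus 2. $\mathrm{Sp}(4,\mathbb{Z})$ is the group of integer $4\times4$ matrices $\Gamma=\begin{pmatrix}A&B\\C&D\end{pmatrix}$ ($2\times2$ blocks) with $\Gamma J\Gamma^T=J$, $J=\begin{pmatrix}0&I_2\\-I_2&0\end{pmatrix}$; it acts on $\mathbb{H}_2$ by $\Gamma\cdot M=(AM+B)(CM+D)^{-1}$. Fixed points: with $\zeta=e^{2\pi i/5}$, $\eta=\tfrac13(1+2\sqrt2\,i)$, $\rho=e^{2\pi i/3}$, $$\sigma_1=\begin{pmatrix}\zeta&\zeta+\zeta^{-2}\\ \zeta+\zeta^{-2}&-\zeta^{-1}\end{pmatrix},\quad \sigma_2=\begin{pmatrix}\eta&\frac12(\eta-1)\\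 \frac12(\eta-1)&\eta\end{pmatrix},\quad \sigma_3=\begin{pmatrix}i&0\\0&i\end{pmatrix},$$ $$\sigma_4=\begin{pmatrix}\rho&0\\0&\rho\end{pmatrix},\quad \sigma_5=\frac{i}{\sqrt3}\begin{pmatrix}2&1\\1&2\end{pmatrix},\quad \sigma_6=\begin{pmatrix}\rho&0\\0&i\end{pmatrix}.$$ Fields: the complex scalars are $T,U,Z$ (with $M\in\mathbb{H}_2$) and the dilaton $S$, ranging over an open subset of $\{\mathrm{Re}\,S>0\}$. Let $Y=-\frac14\det(M-M^\dagger)=\mathrm{Im}\,T\,\mathrm{Im}\,U-(\mathrm{Im}\,Z)^2>0$ and let $\gamma$ be a nonzero real number. The Kähler potential is $$K=-\gamma\ln Y+k(S,\bar S).$$ The superpotential is $$W(S,M)=\frac{\Omega(S)\,\mathcal{H}(M)}{\chi_\gamma(M)},$$ where $\Omega$ is holomorphic in $S$; $\mathcal{H}$ is an $\mathrm{Sp}(4,\mathbb{Z})$-invariant modular function (weight $0$, trivial multiplier system), holomorphic near the point under consideration; and $\chi_\gamma=\chi_\beta^{\alpha}$, $\alpha\beta=\gamma$, $\alpha\in\mathbb R$, is a power of a Siegel cusp form $\chi_\beta$ of degree 2 and weight $\beta$ (i.e. $\chi_\beta$ is holomorphic on $\mathbb{H}_2$ with $\chi_\beta(\Gamma\cdot M)=\det(CM+D)^\beta\chi_\beta(M)$ for all $\Gamma\in\mathrm{Sp}(4,\mathbb Z)$; in the applications $\chi_\beta$ is Igusa's $\chi_{10}$ or $\chi_{12}$),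 assumed nonvanishing at the point under consideration. If $\alpha$ is not an integer a local branch is chosen; $V$ does not depend on it. The scalar potential is $$V=e^{K}\Big(\sum_{I,J\in\{S,T,U,Z\}}K^{I\bar J}F_I\overline{F_J}-3|W|^2\Big),\qquad F_I=\partial_IW+W\,\partial_IK,$$ where $K^{I\bar J}$ is the inverse of the Kähler metric $K_{I\bar J}=\partial_I\partial_{\bar J}K$. *)

theory Defs
  imports "HOL-Analysis.Analysis"
begin
definition holomorphic_sv_on :: "(complex^'n::finite \<Rightarrow> complex) \<Rightarrow> (complex^'n) set \<Rightarrow> bool" where
  "holomorphic_sv_on f A \<longleftrightarrow> open A \<and>
     (\<forall>x\<in>A. \<exists>f'. (f has_derivative f') (at x) \<and> (\<forall>c v. f' (c *s v) = c * f' v))"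

text \<open>
  A meromorphic function on the open set \<open>A\<close> is a holomorphic function on an open dense
  subset \<open>P\<close> of \<open>A\<close> that is, locally around every point of \<open>A\<close>, a quotient of holomorphic
  functions. Values of \<open>f\<close> off \<open>P\<close> are irrelevant.
\<close>
definition meromorphic_sv_on ::
    "(complex^'n::finite \<Rightarrow> complex) \<Rightarrow> (complex^'n) set \<Rightarrow> (complex^'n) set \<Rightarrow> bool" where
  "meromorphic_sv_on f P A \<longleftrightarrow> open A \<and> P \<subseteq> A \<and> A \<subseteq> closure P \<and> holomorphic_sv_on f P \<and>
     (\<forall>x\<in>A. \<exists>B g h. open B \<and> connected B \<and> x \<in> B \<and> B \<subseteq> A \<and>
        holomorphic_sv_on g B \<and> holomorphic_sv_on h B \<and> (\<exists>y\<in>B. h y \<noteq> 0) \<and>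
        (\<forall>y\<in>B \<inter> P. h y * f y = g y))"

definition sym_mat :: "complex^3 \<Rightarrow> complex^2^2" where
  "sym_mat v = vector [vector [v $ 1, v $ 3], vector [v $ 3, v $ 2]]"

definition Im_mat :: "complex^2^2 \<Rightarrow> real^2^2" where
  "Im_mat M = (\<chi> i j. Im (M $ i $ j))"

definition siegel_H2 :: "(complex^2^2) set" where
  "siegel_H2 = {M. transpose M = M \<and> (\<forall>x. x \<noteq> 0 \<longrightarrow> x \<bullet> (Im_mat M *v x) > 0)}"

text \<open>
  Topological and complex-analytic notions on the half-space refer to the three global
  coordinates \<open>(T, U, Z)\<close>, i.e. to preimages under \<^const>\<open>sym_mat\<close>.
\<close>
definition coords :: "(complex^2^2) set \<Rightarrow> (complex^3) set" where
  "coords A = {v. sym_mat v \<in> A}"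

text \<open>
  Integral \<open>4 \<times> 4\<close> matrices are indexed by the sum type \<open>2 + 2\<close>, so that the
  \<open>2 \<times> 2\<close> blocks \<open>A, B, C, D\<close> are obtained by restricting to \<^const>\<open>Inl\<close> and \<^const>\<open>Inr\<close>.
\<close>
type_synonym int_block = "int^(2 + 2)^(2 + 2)"

definition block_A :: "int_block \<Rightarrow> complex^2^2" where
  "block_A G = (\<chi> i j. of_int (G $ Inl i $ Inl j))"
definition block_B :: "int_block \<Rightarrow> complex^2^2" where
  "block_B G = (\<chi> i j. of_int (G $ Inl i $ Inr j))"
definition block_C :: "int_block \<Rightarrow> complex^2^2" where
  "block_C G = (\<chi> i j. of_int (G $ Inr i $ Inl j))"
definition block_D :: "int_block \<Rightarrow> complex^2^2" where
  "block_D G = (\<chi> i j. of_int (G $ Inr i $ Inr j))"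

definition symplectic_J :: int_block where
  "symplectic_J = (\<chi> a b. case (a, b) of
      (Inl i, Inr j) \<Rightarrow> (if i = j then 1 else 0)
    | (Inr i, Inl j) \<Rightarrow> (if i = j then -1 else 0)
    | _ \<Rightarrow> 0)"

definition Sp4Z :: "int_block set" where
  "Sp4Z = {G. G ** symplectic_J ** transpose G = symplectic_J}"

definition siegel_act :: "int_block \<Rightarrow> complex^2^2 \<Rightarrow> complex^2^2" where
  "siegel_act G M = (block_A G ** M + block_B G) ** matrix_inv (block_C G ** M + block_D G)"

text \<open>\<open>P\<close> is the domain on which the meromorphic function \<open>H\<close> is holomorphic.\<close>
definition siegel_modular_function :: "(complex^2^2 \<Rightarrow> complex) \<Rightarrow> (complex^2^2) set \<Rightarrow> bool" where
  "siegel_modular_function H P \<longleftrightarrow> P \<subseteq> siegel_H2 \<and>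
     meromorphic_sv_on (H \<circ> sym_mat) (coords P) (coords siegel_H2) \<and>
     (\<forall>G\<in>Sp4Z. \<forall>M\<in>P. siegel_act G M \<in> P \<and> H (siegel_act G M) = H M)"

text \<open>
  The last clause is the vanishing of the Siegel operator image
  \<open>\<Phi> f (\<tau>) = lim f (diag (\<tau>, i t))\<close> for \<open>t \<rightarrow> \<infinity>\<close>; for the full modular group this is the
  cusp condition.
\<close>
definition siegel_cusp_form :: "int \<Rightarrow> (complex^2^2 \<Rightarrow> complex) \<Rightarrow> bool" where
  "siegel_cusp_form \<beta> f \<longleftrightarrow>
     holomorphic_sv_on (f \<circ> sym_mat) (coords siegel_H2) \<and>
     (\<forall>G\<in>Sp4Z. \<forall>M\<in>siegel_H2.
        f (siegel_act G M) = det (block_C G ** M + block_D G) powi \<beta> * f M) \<and>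
     (\<forall>\<tau>. Im \<tau> > 0 \<longrightarrow>
        ((\<lambda>t::real. f (vector [vector [\<tau>, 0], vector [0, \<i> * of_real t]])) \<longlongrightarrow> 0) at_top)"

text \<open>\<open>X\<close> is a holomorphic branch of \<open>f\<close> to the power \<open>\<alpha>\<close> on the open set \<open>N\<close>, given by a
  branch \<open>L\<close> of \<open>log f\<close>.\<close>
definition power_branch ::
    "real \<Rightarrow> (complex^2^2 \<Rightarrow> complex) \<Rightarrow> (complex^2^2) set \<Rightarrow> (complex^2^2 \<Rightarrow> complex) \<Rightarrow> bool" where
  "power_branch \<alpha> f N X \<longleftrightarrow> N \<subseteq> siegel_H2 \<and>
     (\<exists>L. holomorphic_sv_on (L \<circ> sym_mat) (coords N) \<and>
          (\<forall>M\<in>N. exp (L M) = f M \<and> X M = exp (of_real \<alpha> * L M)))"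

definition zeta5 :: complex where "zeta5 = exp (2 * of_real pi * \<i> / 5)"
definition eta :: complex where "eta = (1 + 2 * of_real (sqrt 2) * \<i>) / 3"
definition rho :: complex where "rho = exp (2 * of_real pi * \<i> / 3)"

definition sigma1 :: "complex^2^2" where
  "sigma1 = vector [vector [zeta5, zeta5 + zeta5 powi (-2)],
                    vector [zeta5 + zeta5 powi (-2), - (zeta5 powi (-1))]]"
definition sigma2 :: "complex^2^2" where
  "sigma2 = vector [vector [eta, (eta - 1) / 2], vector [(eta - 1) / 2, eta]]"
definition sigma3 :: "complex^2^2" where
  "sigma3 = vector [vector [\<i>, 0], vector [0, \<i>]]"
definition sigma4 :: "complex^2^2" where
  "sigma4 = vector [vector [rho, 0], vector [0, rho]]"
definition sigma5 :: "complex^2^2" where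
  "sigma5 = (\<chi> i j. \<i> / of_real (sqrt 3) * vector [vector [2, 1], vector [1, 2 :: complex]] $ i $ j)"
definition sigma6 :: "complex^2^2" where
  "sigma6 = vector [vector [rho, 0], vector [0, \<i>]]"

definition dir_deriv :: "('a::real_normed_vector \<Rightarrow> 'b::real_normed_vector) \<Rightarrow> 'a \<Rightarrow> 'a \<Rightarrow> 'b" where
  "dir_deriv f v p = vector_derivative (\<lambda>t::real. f (p + t *\<^sub>R v)) (at 0)"

definition wirt :: "'n::finite \<Rightarrow> (complex^'n \<Rightarrow> complex) \<Rightarrow> complex^'n \<Rightarrow> complex" where
  "wirt I f p = (dir_deriv f (axis I 1) p - \<i> * dir_deriv f (axis I \<i>) p) / 2"

definition wirt_bar :: "'n::finite \<Rightarrow> (complex^'n \<Rightarrow> complex) \<Rightarrow> complex^'n \<Rightarrow> complex" where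
  "wirt_bar I f p = (dir_deriv f (axis I 1) p + \<i> * dir_deriv f (axis I \<i>) p) / 2"

text \<open>The real coordinate directions of \<open>\<complex>\<^sup>n\<close>: \<^const>\<open>Inl\<close> for real, \<^const>\<open>Inr\<close> for imaginary parts.\<close>
definition real_dir :: "'n::finite + 'n \<Rightarrow> complex^'n" where
  "real_dir a = (case a of Inl I \<Rightarrow> axis I 1 | Inr I \<Rightarrow> axis I \<i>)"

definition real_hessian :: "(complex^'n::finite \<Rightarrow> real) \<Rightarrow> complex^'n \<Rightarrow> real^('n + 'n)^('n + 'n)" where
  "real_hessian f p = (\<chi> a b. dir_deriv (dir_deriv f (real_dir b)) (real_dir a) p)"

definition mat_eigenvalue :: "real^'m::finite^'m \<Rightarrow> real \<Rightarrow> bool" where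
  "mat_eigenvalue A l \<longleftrightarrow> (\<exists>v. v \<noteq> 0 \<and> A *v v = l *s v)"

text \<open>Field space has the coordinates \<open>(S, T, U, Z)\<close>, with indices 1, 2, 3, 4 in this order.\<close>
definition moduli :: "complex^4 \<Rightarrow> complex^2^2" where
  "moduli p = sym_mat (vector [p $ 2, p $ 3, p $ 4])"

definition field_point :: "complex \<Rightarrow> complex^2^2 \<Rightarrow> complex^4" where
  "field_point S M = vector [S, M $ 1 $ 1, M $ 2 $ 2, M $ 1 $ 2]"

lemma moduli_field_point:
  assumes "transpose M = M"
  shows "moduli (field_point S M) = M" and "field_point S M $ 1 = S"
proof -
  have "M $ 2 $ 1 = M $ 1 $ 2"
    using arg_cong[OF assms, of "\<lambda>A. A $ 1 $ 2"] by (simp add: transpose_def)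
  then show "moduli (field_point S M) = M"
    by (simp add: moduli_def field_point_def sym_mat_def vec_eq_iff forall_2 vector_def)
qed (simp add: field_point_def vector_def)

definition conj_transpose :: "complex^2^2 \<Rightarrow> complex^2^2" where
  "conj_transpose M = (\<chi> i j. cnj (M $ j $ i))"

definition Y_fun :: "complex^2^2 \<Rightarrow> real" where
  "Y_fun M = Re (- (1/4) * det (M - conj_transpose M))"

lemma Y_fun_sym_mat: "Y_fun (sym_mat v) = Im (v $ 1) * Im (v $ 2) - (Im (v $ 3))\<^sup>2"
  by (simp add: Y_fun_def sym_mat_def conj_transpose_def det_2 complex_eq_iff power2_eq_square field_simps)

definition dilaton_kaehler :: "complex \<Rightarrow> real" where
  "dilaton_kaehler S = - ln (Re (S + cnj S))"

definition kaehler_potential :: "real \<Rightarrow> (complex \<Rightarrow> real) \<Rightarrow> complex^4 \<Rightarrow> real" where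
  "kaehler_potential \<gamma> k p = - \<gamma> * ln (Y_fun (moduli p)) + k (p $ 1)"

definition superpotential ::
    "(complex \<Rightarrow> complex) \<Rightarrow> (complex^2^2 \<Rightarrow> complex) \<Rightarrow> (complex^2^2 \<Rightarrow> complex) \<Rightarrow> complex^4 \<Rightarrow> complex" where
  "superpotential \<Omega> H X p = \<Omega> (p $ 1) * H (moduli p) / X (moduli p)"

definition kaehler_metric :: "(complex^4 \<Rightarrow> real) \<Rightarrow> complex^4 \<Rightarrow> complex^4^4" where
  "kaehler_metric K p = (\<chi> I J. wirt I (wirt_bar J (\<lambda>q. of_real (K q))) p)"

text \<open>The index convention is \<open>\<Sum>\<^sub>J K\<^sup>I\<^sup>J K\<^sub>L\<^sub>J = \<delta>\<^sup>I\<^sub>L\<close> (second index barred), which makes the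
  contraction in the potential covariant; hence the transpose.\<close>
definition inverse_kaehler_metric :: "(complex^4 \<Rightarrow> real) \<Rightarrow> complex^4 \<Rightarrow> complex^4^4" where
  "inverse_kaehler_metric K p = transpose (matrix_inv (kaehler_metric K p))"

definition F_term :: "(complex^4 \<Rightarrow> real) \<Rightarrow> (complex^4 \<Rightarrow> complex) \<Rightarrow> 4 \<Rightarrow> complex^4 \<Rightarrow> complex" where
  "F_term K W I p = wirt I W p + W p * wirt I (\<lambda>q. of_real (K q)) p"

text \<open>The contraction is real because the metric is Hermitian; \<^const>\<open>Re\<close> only changes the type.\<close>
definition scalar_potential :: "(complex^4 \<Rightarrow> real) \<Rightarrow> (complex^4 \<Rightarrow> complex) \<Rightarrow> complex^4 \<Rightarrow> real" where
  "scalar_potential K W p = exp (K p) *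
     (Re (\<Sum>I\<in>UNIV. \<Sum>J\<in>UNIV.
            inverse_kaehler_metric K p $ I $ J * F_term K W I p * cnj (F_term K W J p))
      - 3 * (norm (W p))\<^sup>2)"

end

theory Submission
  imports Defs "HOL-Complex_Analysis.Cauchy_Integral_Formula"
begin

text \<open>
  At an elliptic fixed point \<open>M\<^sub>0\<close> some element of the stabiliser acts on the tangent space without
  the eigenvalue \<open>1\<close>, so every invariant covector there is zero. Applied to \<open>dH\<close> and to
  \<open>d log chi + \<beta> \<partial> log Y\<close>, this shows that the F-terms of the moduli \<open>T, U, Z\<close> vanish at \<open>M\<^sub>0\<close> for every
  value of \<open>S\<close>. Near \<open>M\<^sub>0\<close> the potential has the form \<open>V = a(S) A(M) + w(S) B(M)\<close>, where
  \<open>A = Y\<^sup>-\<^sup>\<gamma> |H / X|\<^sup>2\<close> and \<open>B\<close> is quadratic in these F-terms. Hence \<open>A\<close> and \<open>B\<close> are stationary at \<open>M\<^sub>0\<close>,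
  and an eigenvector of the \<open>S\<close>-block of the Hessian is, extended by zero, one of the whole Hessian.
  With \<open>x = 2 Re S\<close> and \<open>f = x \<Omega>' - \<Omega>\<close> one has \<open>a = (|f|\<^sup>2 - 3 |\<Omega>|\<^sup>2) / x\<close>, and at a critical point of \<open>a\<close> with
  \<open>f \<noteq> 0\<close> the trace of the \<open>S\<close>-block is a positive multiple of \<open>|\<Omega>|\<^sup>2 - |f|\<^sup>2\<close>, which is negative if \<open>a > 0\<close>.
\<close>

section \<open>Symplectic matrices in block form\<close>

text \<open>Two obstacles shape the argument. Holomorphy is plain complex differentiability, so
  second derivatives of the moduli functions are not directly at hand. The Hessian is an iterated
  directional derivative whose column direction is applied first, and a vector supported on S meets
  only the columns of S. Differentiating in S first leaves A and B to be differentiated once along a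
  line in the moduli; for B it is enough that the F-terms are O(t) there, which Cauchy estimates
  provide. The other obstacle is the differential of M -> (A M + B) (C M + D)^(-1). The action is
  evaluated along M + t J^T f J with J = C M + D taken at the fixed point: there J cancels and the
  image leaves M with velocity f, so invariance of a covector is tested against the polynomial
  congruence f -> J^T f J. A form of weight \<beta> picks up a trace term from its automorphy
  factor; \<partial> log Y picks up a matching term, and the combination is a genuine invariant
  covector.\<close>

definition m2 :: "'a \<Rightarrow> 'a \<Rightarrow> 'a \<Rightarrow> 'a \<Rightarrow> 'a::zero^2^2" where
  "m2 a b c d = vector [vector [a, b], vector [c, d]]"

lemma m2_nth [simp]:
  "m2 a b c d $ 1 $ 1 = a" "m2 a b c d $ 1 $ 2 = b" "m2 a b c d $ 2 $ 1 = c" "m2 a b c d $ 2 $ 2 = d"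
  by (simp_all add: m2_def)

lemma m2_eta: "m2 (M $ 1 $ 1) (M $ 1 $ 2) (M $ 2 $ 1) (M $ 2 $ 2) = M"
  by (simp add: vec_eq_iff forall_2)

lemma m2_eq_iff: "m2 a b c d = m2 a' b' c' d' \<longleftrightarrow> a = a' \<and> b = b' \<and> c = c' \<and> d = d'"
  by (auto simp: vec_eq_iff forall_2)

lemma m2_mult: "m2 a b c d ** m2 a' b' c' d' =
    m2 (a * a' + b * c') (a * b' + b * d') (c * a' + d * c') (c * b' + d * (d' :: 'a::semiring_1))"
  by (simp add: vec_eq_iff forall_2 matrix_matrix_mult_def sum_2)

lemma m2_add: "m2 a b c d + m2 a' b' c' d' = m2 (a + a') (b + b') (c + c') (d + (d' :: 'a::monoid_add))"
  by (simp add: vec_eq_iff forall_2)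

lemma m2_transpose: "transpose (m2 a b c d) = m2 a c b d"
  by (simp add: vec_eq_iff forall_2 transpose_def)

lemma m2_one: "mat 1 = m2 1 0 0 (1 :: 'a::zero_neq_one)"
  by (simp add: vec_eq_iff forall_2 mat_def)

lemma m2_det: "det (m2 a b c d) = a * d - b * (c :: 'a::comm_ring_1)"
  by (simp add: det_2)

lemma m2_trace: "trace (m2 a b c d) = a + (d :: 'a::comm_ring_1)"
  by (simp add: trace_def sum_2)

lemmas m2_simps = m2_mult m2_add m2_transpose m2_one m2_det m2_trace m2_eq_iff

lemma sym_mat_eq_m2: "sym_mat v = m2 (v $ 1) (v $ 3) (v $ 3) (v $ 2)"
  by (simp add: sym_mat_def m2_def)

lemma sum_UNIV_Plus: "(\<Sum>x\<in>UNIV. f x) = (\<Sum>i\<in>UNIV. f (Inl i)) + (\<Sum>i\<in>UNIV. f (Inr i))"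
  for f :: "'a::finite + 'b::finite \<Rightarrow> 'c::comm_monoid_add"
  by (simp add: UNIV_Plus_UNIV [symmetric] sum.Plus del: UNIV_Plus_UNIV)

text \<open>Entry (a, b) of G J G^T is a difference that changes sign when a and b are exchanged.
  The lower left block therefore repeats the upper right one, and three families of equations
  remain.\<close>

lemma Sp4Z_iff: "G \<in> Sp4Z \<longleftrightarrow>
    (\<forall>i j. (\<Sum>k\<in>UNIV. G $ Inl i $ Inl k * G $ Inl j $ Inr k) = (\<Sum>k\<in>UNIV. G $ Inl i $ Inr k * G $ Inl j $ Inl k)) \<and>
    (\<forall>i j. (\<Sum>k\<in>UNIV. G $ Inr i $ Inl k * G $ Inr j $ Inr k) = (\<Sum>k\<in>UNIV. G $ Inr i $ Inr k * G $ Inr j $ Inl k)) \<and>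
    (\<forall>i j. (\<Sum>k\<in>UNIV. G $ Inl i $ Inl k * G $ Inr j $ Inr k) - (\<Sum>k\<in>UNIV. G $ Inl i $ Inr k * G $ Inr j $ Inl k)
        = (if i = j then 1 else 0))"
  (is "_ \<longleftrightarrow> ?R")
proof -
  have entry: "(G ** symplectic_J ** transpose G) $ a $ b =
      (\<Sum>k\<in>UNIV. G $ a $ Inl k * G $ b $ Inr k) - (\<Sum>k\<in>UNIV. G $ a $ Inr k * G $ b $ Inl k)" for a b
    by (simp add: matrix_matrix_mult_def sum_UNIV_Plus symplectic_J_def transpose_def
        if_distrib [of "(*) _"] sum_negf sum.delta cong: if_cong)
  have "G \<in> Sp4Z \<longleftrightarrow> (\<forall>a b. (G ** symplectic_J ** transpose G) $ a $ b = symplectic_J $ a $ b)"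
    by (simp add: Sp4Z_def vec_eq_iff)
  also have "\<dots> \<longleftrightarrow> ?R"
    unfolding entry
    by (simp add: split_sum_all symplectic_J_def algebra_simps sum_2 forall_2) (safe; linarith?)
  finally show ?thesis .
qed

lemma Sp4Z_blocks:
  assumes "G \<in> Sp4Z"
  shows "block_C G ** transpose (block_D G) = block_D G ** transpose (block_C G)"
    and "block_A G ** transpose (block_D G) = block_B G ** transpose (block_C G) + mat 1"
proof -
  have "(\<Sum>k\<in>UNIV. G $ Inr i $ Inl k * G $ Inr j $ Inr k) =
      (\<Sum>k\<in>UNIV. G $ Inr i $ Inr k * G $ Inr j $ Inl k)" for i j
    using assms unfolding Sp4Z_iff by blast
  from arg_cong [OF this, of "of_int :: int \<Rightarrow> complex"]
  show "block_C G ** transpose (block_D G) = block_D G ** transpose (block_C G)"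
    by (simp add: vec_eq_iff matrix_matrix_mult_def transpose_def block_C_def block_D_def)
  have "(\<Sum>k\<in>UNIV. G $ Inl i $ Inl k * G $ Inr j $ Inr k) =
      (\<Sum>k\<in>UNIV. G $ Inl i $ Inr k * G $ Inr j $ Inl k) + (if i = j then 1 else 0)" for i j
    using assms unfolding Sp4Z_iff by (simp add: algebra_simps)
  from arg_cong [OF this, of "of_int :: int \<Rightarrow> complex"]
  show "block_A G ** transpose (block_D G) = block_B G ** transpose (block_C G) + mat 1"
    by (simp add: vec_eq_iff matrix_matrix_mult_def transpose_def block_A_def block_B_def block_C_def block_D_def
        mat_def)
qed

lemma transpose_add: "transpose (A + B) = transpose A + transpose (B :: 'a::plus^'n^'m)"
  by (simp add: vec_eq_iff transpose_def)

lemma matrix_add_rdistrib: "(A + B) ** C = A ** C + B ** (C :: 'a::semiring_1^'n^'m)"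
  by (simp add: vec_eq_iff matrix_matrix_mult_def sum.distrib distrib_right)

text \<open>J is the automorphy factor at the fixed point, and C J^T = C M C^T + C D^T is symmetric
  because both summands are. The second identity reads (A - M C) J^T = 1, so J is invertible and the
  differential of the action, E -> (A - M C) E J^(-1), equals E -> J^(-T) E J^(-1).\<close>

lemma symplectic_fixed_point_relations:
  fixes A B C D M :: "complex^2^2"
  assumes CD: "C ** transpose D = D ** transpose C"
    and AD: "A ** transpose D = B ** transpose C + mat 1"
    and fixed: "A ** M + B = M ** (C ** M + D)" and sym: "transpose M = M"
  defines "J \<equiv> C ** M + D"
  shows "transpose (C ** transpose J) = C ** transpose J"
    and "M ** (C ** transpose J) + mat 1 = A ** transpose J"
proof -
  have Jt: "transpose J = M ** transpose C + transpose D"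
    by (simp add: J_def transpose_add matrix_transpose_mul sym)
  have CJ: "C ** transpose J = J ** transpose C"
    unfolding Jt by (simp add: J_def matrix_add_ldistrib matrix_add_rdistrib matrix_mul_assoc CD)
  then show "transpose (C ** transpose J) = C ** transpose J"
    by (metis matrix_transpose_mul transpose_transpose)
  have "A ** transpose J = (A ** M + B) ** transpose C + mat 1"
    by (simp add: Jt matrix_add_ldistrib matrix_add_rdistrib matrix_mul_assoc AD)
  then show "M ** (C ** transpose J) + mat 1 = A ** transpose J"
    by (simp add: fixed CJ matrix_mul_assoc flip: J_def)
qed

text \<open>The congruence E -> J^T E J in the coordinates (T, U, Z). For the automorphy factor J at
  a fixed point it is the inverse of the differential of the action.\<close>

definition cong_act :: "complex^2^2 \<Rightarrow> complex^3 \<Rightarrow> complex^3" where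
  "cong_act J w = vector
    [(J $ 1 $ 1)\<^sup>2 * w $ 1 + (J $ 2 $ 1)\<^sup>2 * w $ 2 + 2 * J $ 1 $ 1 * J $ 2 $ 1 * w $ 3,
     (J $ 1 $ 2)\<^sup>2 * w $ 1 + (J $ 2 $ 2)\<^sup>2 * w $ 2 + 2 * J $ 1 $ 2 * J $ 2 $ 2 * w $ 3,
     J $ 1 $ 1 * J $ 1 $ 2 * w $ 1 + J $ 2 $ 1 * J $ 2 $ 2 * w $ 2
       + (J $ 1 $ 1 * J $ 2 $ 2 + J $ 1 $ 2 * J $ 2 $ 1) * w $ 3]"

lemma sym_mat_cong_act: "sym_mat (cong_act J w) = transpose J ** sym_mat w ** J"
proof -
  obtain p q r s where J: "J = m2 p q r s"
    using m2_eta [of J, symmetric] by blast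
  show ?thesis
    by (simp add: J sym_mat_eq_m2 m2_simps cong_act_def power2_eq_square algebra_simps)
qed

text \<open>
  The eigenvalues of \<^const>\<open>cong_act\<close> \<open>J\<close> are \<open>l\<^sup>2\<close>, \<open>m\<^sup>2\<close> and \<open>l m\<close>, where \<open>l\<close> and \<open>m\<close>
  are those of \<open>J\<close>. The two inequations say that none of them is \<open>1\<close>, since
  \<open>(l\<^sup>2 - 1) (m\<^sup>2 - 1) = (det J + 1)\<^sup>2 - (trace J)\<^sup>2\<close>.
\<close>
lemma cong_act_invariant_form_zero:
  fixes x y z :: complex
  assumes inv: "\<And>w. x * w $ 1 + y * w $ 2 + z * w $ 3 =
      x * cong_act J w $ 1 + y * cong_act J w $ 2 + z * cong_act J w $ 3"
    and det: "det J \<noteq> 1" and tr: "(det J + 1)\<^sup>2 \<noteq> (trace J)\<^sup>2"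
  shows "x = 0 \<and> y = 0 \<and> z = 0"
proof -
  obtain p q r s where J: "J = m2 p q r s"
    using m2_eta [of J, symmetric] by blast
  define e1 where "e1 = p\<^sup>2 * x + q\<^sup>2 * y + p * q * z - x"
  define e2 where "e2 = r\<^sup>2 * x + s\<^sup>2 * y + r * s * z - y"
  define e3 where "e3 = 2 * p * r * x + 2 * q * s * y + (p * s + q * r) * z - z"
  have z: "e1 = 0" "e2 = 0" "e3 = 0"
    using inv [of "vector [1, 0, 0]"] inv [of "vector [0, 1, 0]"] inv [of "vector [0, 0, 1]"]
    by (simp_all add: e1_def e2_def e3_def cong_act_def J algebra_simps)
  \<comment> \<open>Cramer's rule: \<open>d\<close> is the determinant of the linear system
    \<open>e1\<close>, \<open>e2\<close>, \<open>e3\<close> in x, y, z, factored as (l m - 1) (l^2 -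
    1) (m^2 - 1), and the multipliers of \<open>e1\<close>, \<open>e2\<close>, \<open>e3\<close>
    below are its cofactors.\<close>
  define d where "d = (p * s - q * r - 1) * ((p * s - q * r + 1)\<^sup>2 - (p + s)\<^sup>2)"
  have d: "d \<noteq> 0"
    using det tr by (simp add: d_def J m2_simps)
  have "d * x = ((s\<^sup>2 - 1) * (p * s + q * r - 1) - (r * s) * (2 * q * s)) * e1 + ((p * q) * (2 * q * s) - q\<^sup>2 * (p * s + q * r - 1)) * e2 + (q\<^sup>2 * (r * s) - (p * q) * (s\<^sup>2 - 1)) * e3"
    unfolding d_def e1_def e2_def e3_def by (simp add: algebra_simps power2_eq_square)
  then have dx: "d * x = 0"
    by (simp add: z)
  have "d * y = ((r * s) * (2 * p * r) - r\<^sup>2 * (p * s + q * r - 1)) * e1 + ((p\<^sup>2 - 1) * (p * s + q * r - 1) - (p * q) * (2 * p * r)) * e2 + ((p * q) * r\<^sup>2 - (p\<^sup>2 - 1) * (r * s)) * e3"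
    unfolding d_def e1_def e2_def e3_def by (simp add: algebra_simps power2_eq_square)
  then have dy: "d * y = 0"
    by (simp add: z)
  have "d * z = (r\<^sup>2 * (2 * q * s) - (s\<^sup>2 - 1) * (2 * p * r)) * e1 + (q\<^sup>2 * (2 * p * r) - (p\<^sup>2 - 1) * (2 * q * s)) * e2 + ((p\<^sup>2 - 1) * (s\<^sup>2 - 1) - q\<^sup>2 * r\<^sup>2) * e3"
    unfolding d_def e1_def e2_def e3_def by (simp add: algebra_simps power2_eq_square)
  then have dz: "d * z = 0"
    by (simp add: z)
  show ?thesis
    using d dx dy dz by simp
qed

section \<open>The modular action near a fixed point\<close>

lemma matrix_diff_ldistrib: "A ** (B - C) = A ** B - A ** (C :: 'a::ring_1^'n^'m)"
  by (simp add: vec_eq_iff matrix_matrix_mult_def sum_subtractf right_diff_distrib)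

lemma matrix_diff_rdistrib: "(A - B) ** C = A ** C - B ** (C :: 'a::ring_1^'n^'m)"
  by (simp add: vec_eq_iff matrix_matrix_mult_def sum_subtractf left_diff_distrib)

lemma scaleR_matrix_mult: "(k *\<^sub>R A) ** B = k *\<^sub>R (A ** B)" "A ** (k *\<^sub>R B) = k *\<^sub>R (A ** B)"
  for A :: "'a::real_algebra_1^'n^'m"
  by (simp_all add: vec_eq_iff matrix_matrix_mult_def scaleR_sum_right)

lemma mult_matrix_inv:
  fixes A :: "'a::field^'n^'n"
  assumes "det A \<noteq> 0"
  shows "A ** matrix_inv A = mat 1"
proof -
  have "\<exists>B. A ** B = mat 1 \<and> B ** A = mat 1"
    using assms unfolding invertible_det_nz [symmetric] invertible_def .
  from someI_ex [OF this] show ?thesis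
    by (simp add: matrix_inv_def)
qed

text \<open>Along the displacement t J^T f J the denominator is R J and the numerator (M R + t f) J,
  with R = 1 + t Q f, so J cancels and the image is M + t f R^(-1). \<open>K\<close> stands for f
  R^(-1); it is kept abstract so that an explicitly symmetric formula can be inserted.\<close>

lemma siegel_act_near_fixed_point:
  fixes M f K :: "complex^2^2" and t :: real
  assumes G: "G \<in> Sp4Z" and sym: "transpose M = M"
    and fixed: "block_A G ** M + block_B G = M ** (block_C G ** M + block_D G)"
  defines "J \<equiv> block_C G ** M + block_D G"
  defines "Q \<equiv> block_C G ** transpose J"
  assumes det: "det (mat 1 + t *\<^sub>R (Q ** f)) \<noteq> 0" and K: "K ** (mat 1 + t *\<^sub>R (Q ** f)) = f"
  shows "det J \<noteq> 0"
    and "det (block_C G ** (M + t *\<^sub>R (transpose J ** f ** J)) + block_D G) = det (mat 1 + t *\<^sub>R (Q ** f)) * det J"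
    and "siegel_act G (M + t *\<^sub>R (transpose J ** f ** J)) = M + t *\<^sub>R K"
proof -
  have MQ: "M ** Q + mat 1 = block_A G ** transpose J"
    using symplectic_fixed_point_relations [OF Sp4Z_blocks [OF G] fixed sym] by (simp add: Q_def J_def)
  have "(block_A G - M ** block_C G) ** transpose J = mat 1"
    using MQ by (simp add: matrix_diff_rdistrib Q_def matrix_mul_assoc algebra_simps)
  from arg_cong [OF this, of det] show J0: "det J \<noteq> 0"
    by (auto simp: det_mul det_transpose det_I)
  let ?E = "transpose J ** f ** J"
  let ?R = "mat 1 + t *\<^sub>R (Q ** f)"
  have den: "block_C G ** (M + t *\<^sub>R ?E) + block_D G = ?R ** J"
    by (simp add: matrix_add_ldistrib matrix_add_rdistrib scaleR_matrix_mult J_def Q_def matrix_mul_assoc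
        scaleR_right_distrib)
  then show d: "det (block_C G ** (M + t *\<^sub>R ?E) + block_D G) = det ?R * det J"
    by (simp add: det_mul)
  have "block_A G ** (M + t *\<^sub>R ?E) + block_B G = M ** J + t *\<^sub>R (block_A G ** transpose J ** f ** J)"
    using fixed by (simp add: matrix_add_ldistrib scaleR_matrix_mult J_def matrix_mul_assoc algebra_simps)
  also have "\<dots> = (M ** ?R + t *\<^sub>R f) ** J"
    by (simp add: MQ [symmetric] matrix_add_ldistrib matrix_add_rdistrib scaleR_matrix_mult matrix_mul_assoc
        scaleR_right_distrib)
  also have "\<dots> = (M + t *\<^sub>R K) ** (?R ** J)"
    by (subst (2) K [symmetric])
      (simp only: matrix_add_rdistrib [of M "t *\<^sub>R K"] scaleR_matrix_mult matrix_mul_assoc)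
  finally have "siegel_act G (M + t *\<^sub>R ?E) = (M + t *\<^sub>R K) ** ((?R ** J) ** matrix_inv (?R ** J))"
    unfolding siegel_act_def den by (simp add: matrix_mul_assoc)
  then show "siegel_act G (M + t *\<^sub>R ?E) = M + t *\<^sub>R K"
    using det J0 by (subst (asm) mult_matrix_inv) (auto simp: det_mul)
qed

lemma sym_mat_add: "sym_mat (v + w) = sym_mat v + sym_mat w"
  and sym_mat_scaleR: "sym_mat (k *\<^sub>R v) = k *\<^sub>R sym_mat v"
  and transpose_sym_mat: "transpose (sym_mat v) = sym_mat v"
  by (simp_all add: vec_eq_iff forall_2 sym_mat_eq_m2 transpose_def)

text \<open>The factor t makes continuity of \<open>k\<close> at 0 enough, so the quotient inside
  the image curve never has to be differentiated.\<close>

lemma has_vector_derivative_add_scaleR: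
  fixes k :: "real \<Rightarrow> 'a::real_normed_vector"
  assumes "isCont k 0"
  shows "((\<lambda>t. v + t *\<^sub>R k t) has_vector_derivative k 0) (at 0)"
proof -
  have "((\<lambda>h. norm (k h - k 0)) \<longlongrightarrow> 0) (at 0)"
    using assms by (simp add: isCont_def tendsto_norm_zero_iff LIM_zero_iff)
  then have "((\<lambda>h. norm (h *\<^sub>R k h - h *\<^sub>R k 0) / norm h) \<longlongrightarrow> 0) (at 0)"
    by (rule Lim_transform_eventually)
       (auto simp: eventually_at_filter simp flip: scaleR_diff_right intro!: always_eventually)
  then show ?thesis
    unfolding has_vector_derivative_def has_derivative_at by (auto intro!: bounded_linear_intros)
qed

text \<open>The curve \<open>n\<close> is the image of a line under G, and \<open>m\<close> is the
  automorphy factor along that line. Together they allow a transformation law to be differentiated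
  in one real variable.\<close>

lemma siegel_act_curve:
  fixes v w :: "complex^3"
  assumes G: "G \<in> Sp4Z"
    and fixed: "block_A G ** sym_mat v + block_B G = sym_mat v ** (block_C G ** sym_mat v + block_D G)"
  defines "J \<equiv> block_C G ** sym_mat v + block_D G"
  defines "Q \<equiv> block_C G ** transpose J"
  obtains n :: "real \<Rightarrow> complex^3" and m :: "real \<Rightarrow> complex" where
    "n 0 = v" "(n has_vector_derivative w) (at 0)"
    "m 0 = det J" "(m has_vector_derivative trace (Q ** sym_mat w) * det J) (at 0)" "det J \<noteq> 0"
    "\<forall>\<^sub>F t in nhds 0. det (block_C G ** sym_mat (v + t *\<^sub>R cong_act J w) + block_D G) = m t \<and>
       siegel_act G (sym_mat (v + t *\<^sub>R cong_act J w)) = sym_mat (n t)"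
proof -
  \<comment> \<open>For 2x2 matrices Cayley-Hamilton gives f Q f = tr(Q f) f - det f adj Q. Hence f
    (1 + t Q f)^(-1) = (f + t det f adj Q) / d(t) with d(t) = det (1 + t Q f). The vector
    \<open>c\<close> holds the coordinates of det f adj Q, which is symmetric because Q is.\<close>
  define d where "d = (\<lambda>t::real. 1 + t * trace (Q ** sym_mat w) + of_real t * of_real t * (det Q * det (sym_mat w)))"
  define c where "c = det (sym_mat w) *s (vector [Q $ 2 $ 2, Q $ 1 $ 1, - (Q $ 1 $ 2)] :: complex^3)"
  define k where "k = (\<lambda>t::real. inverse (d t) *s (w + t *\<^sub>R c))"
  define n where "n = (\<lambda>t::real. v + t *\<^sub>R k t)"
  have Qsym: "Q $ 2 $ 1 = Q $ 1 $ 2"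
    using arg_cong [OF symplectic_fixed_point_relations(1) [OF Sp4Z_blocks [OF G] fixed transpose_sym_mat],
        of "\<lambda>A. A $ 1 $ 2"]
    by (simp add: Q_def J_def transpose_def)
  have "Q = m2 (Q $ 1 $ 1) (Q $ 1 $ 2) (Q $ 1 $ 2) (Q $ 2 $ 2)"
    by (simp add: vec_eq_iff forall_2 Qsym)
  then obtain q1 q2 q3 where Q: "Q = m2 q1 q3 q3 q2"
    by blast
  have R: "mat 1 + t *\<^sub>R (Q ** sym_mat w) = m2 (1 + t * (q1 * w$1 + q3 * w$3)) (t * (q1 * w$3 + q3 * w$2))
      (t * (q3 * w$1 + q2 * w$3)) (1 + t * (q3 * w$3 + q2 * w$2))" for t
    by (simp add: vec_eq_iff forall_2 Q sym_mat_eq_m2 m2_mult m2_one) (simp add: scaleR_conv_of_real)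
  have dR: "det (mat 1 + t *\<^sub>R (Q ** sym_mat w)) = d t" for t
    unfolding R by (simp add: d_def Q sym_mat_eq_m2 m2_simps algebra_simps power2_eq_square)
  have dc: "isCont d 0"
    unfolding d_def by (intro continuous_intros)
  then have "(d \<longlongrightarrow> d 0) (nhds 0)"
    by (simp add: isCont_def tendsto_at_iff_tendsto_nhds)
  then have d_ev: "\<forall>\<^sub>F t in nhds 0. d t \<noteq> 0"
    by (rule tendsto_imp_eventually_ne) (simp add: d_def)
  have kR: "sym_mat (k t) ** (mat 1 + t *\<^sub>R (Q ** sym_mat w)) = sym_mat w" if "d t \<noteq> 0" for t
  proof -
    define D where "D = w$1 * w$2 - w$3 * w$3"
    have de: "d t = 1 + t * (q1 * w$1 + 2 * q3 * w$3 + q2 * w$2) + t * t * ((q1 * q2 - q3 * q3) * D)"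
      by (simp add: d_def D_def Q sym_mat_eq_m2 m2_simps algebra_simps power2_eq_square)
    have sc: "sym_mat (w + t *\<^sub>R c) = m2 (w$1 + t * D * q2) (w$3 - t * D * q3) (w$3 - t * D * q3) (w$2 + t * D * q1)"
      unfolding c_def D_def by (simp add: Q sym_mat_eq_m2 m2_simps) (simp add: scaleR_conv_of_real algebra_simps)
    have "sym_mat (w + t *\<^sub>R c) ** (mat 1 + t *\<^sub>R (Q ** sym_mat w)) =
        m2 (d t * w$1) (d t * w$3) (d t * w$3) (d t * w$2)"
      unfolding R sc de by (simp add: m2_simps D_def algebra_simps)
    also have "\<dots> = mat (d t) ** sym_mat w"
      by (simp add: vec_eq_iff forall_2 mat_def matrix_matrix_mult_def sum_2 sym_mat_eq_m2)
    finally have "sym_mat (w + t *\<^sub>R c) ** (mat 1 + t *\<^sub>R (Q ** sym_mat w)) = mat (d t) ** sym_mat w" .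
    moreover have "sym_mat (k t) = mat (inverse (d t)) ** sym_mat (w + t *\<^sub>R c)"
      by (simp add: k_def sym_mat_eq_m2 vec_eq_iff forall_2 mat_def matrix_matrix_mult_def sum_2 algebra_simps)
    ultimately have "sym_mat (k t) ** (mat 1 + t *\<^sub>R (Q ** sym_mat w)) = mat (inverse (d t)) ** (mat (d t) ** sym_mat w)"
      by (simp add: matrix_mul_assoc [symmetric])
    then show ?thesis
      using that by (simp add: vec_eq_iff forall_2 mat_def matrix_matrix_mult_def sum_2 sym_mat_eq_m2)
  qed
  from d_ev have ev: "\<forall>\<^sub>F t in nhds 0. det (block_C G ** sym_mat (v + t *\<^sub>R cong_act J w) + block_D G) = d t * det J \<and>
       siegel_act G (sym_mat (v + t *\<^sub>R cong_act J w)) = sym_mat (n t)"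
  proof (rule eventually_mono)
    fix t assume "d t \<noteq> 0"
    then show "det (block_C G ** sym_mat (v + t *\<^sub>R cong_act J w) + block_D G) = d t * det J \<and>
       siegel_act G (sym_mat (v + t *\<^sub>R cong_act J w)) = sym_mat (n t)"
      using siegel_act_near_fixed_point(2,3) [OF G transpose_sym_mat fixed, folded J_def, folded Q_def,
          of t "sym_mat w" "sym_mat (k t)"] kR [of t]
      by (simp add: dR n_def sym_mat_add sym_mat_scaleR sym_mat_cong_act)
  qed
  have "d 0 = 1"
    by (simp add: d_def)
  have J0: "det J \<noteq> 0"
    using siegel_act_near_fixed_point(1) [OF G transpose_sym_mat fixed, folded J_def, folded Q_def,
          of 0 "sym_mat w" "sym_mat w"] by (simp add: det_I)
  have dd: "(d has_vector_derivative trace (Q ** sym_mat w)) (at 0)"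
    unfolding d_def by (auto intro!: derivative_eq_intros)
  have "((\<lambda>t. inverse (d t) * (w $ i + t * c $ i)) \<longlongrightarrow> inverse (d 0) * (w $ i + of_real 0 * c $ i)) (at 0)" for i
    using dc by (intro tendsto_intros) (auto simp: isCont_def \<open>d 0 = 1\<close>)
  moreover have "k t $ i = inverse (d t) * (w $ i + t * c $ i)" for t i
    unfolding scaleR_conv_of_real [symmetric] by (simp add: k_def algebra_simps)
  ultimately have kc: "isCont k 0"
    unfolding isCont_def by (intro vec_tendstoI) simp
  have "(n has_vector_derivative k 0) (at 0)"
    unfolding n_def by (rule has_vector_derivative_add_scaleR [OF kc])
  then have nd: "(n has_vector_derivative w) (at 0)"
    by (simp add: k_def \<open>d 0 = 1\<close>)
  show thesis
  proof (rule that [of n "\<lambda>t. d t * det J"])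
    show "n 0 = v" "d 0 * det J = det J"
      by (simp_all add: n_def \<open>d 0 = 1\<close>)
    show "((\<lambda>t. d t * det J) has_vector_derivative trace (Q ** sym_mat w) * det J) (at 0)"
      using has_vector_derivative_mult_left [OF dd] .
  qed (use ev nd J0 in simp_all)
qed

lemma nhds_curve: "open U \<Longrightarrow> v \<in> U \<Longrightarrow> \<forall>\<^sub>F t in nhds 0. v + t *\<^sub>R e \<in> U"
  for v e :: "'a::real_normed_vector"
proof -
  assume U: "open U" "v \<in> U"
  have "((\<lambda>t. v + t *\<^sub>R e) \<longlongrightarrow> v + 0 *\<^sub>R e) (nhds 0)"
    by (intro tendsto_intros filterlim_ident)
  from topological_tendstoD [OF this U(1)] show ?thesis
    using U(2) by simp
qed

lemma has_vector_derivative_eventually_eq: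
  assumes "(f has_vector_derivative a) (at x)" "(g has_vector_derivative b) (at x)"
    and "\<forall>\<^sub>F t in nhds x. f t = g t"
  shows "a = b"
proof -
  obtain S where S: "open S" "x \<in> S" "\<And>t. t \<in> S \<Longrightarrow> f t = g t"
    using assms(3) unfolding eventually_nhds by blast
  have "(g has_vector_derivative a) (at x)"
    by (rule has_vector_derivative_transform_within_open [OF assms(1) S])
  then show ?thesis
    using assms(2) by (rule vector_derivative_unique_at)
qed

lemma has_vector_derivative_compose:
  assumes "(f has_derivative f') (at (n t))" "(n has_vector_derivative w) (at t)"
  shows "((\<lambda>t. f (n t)) has_vector_derivative f' w) (at t)"
proof -
  interpret bounded_linear f'
    by (rule has_derivative_bounded_linear [OF assms(1)])
  show ?thesis
    using has_derivative_compose [OF assms(2) [unfolded has_vector_derivative_def] assms(1)]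
    by (simp add: has_vector_derivative_def scaleR)
qed

lemma has_vector_derivative_line:
  "((\<lambda>t. v + t *\<^sub>R e) has_vector_derivative e) (at t)"
proof -
  have "((\<lambda>t. v + t *\<^sub>R e) has_vector_derivative 0 + (t *\<^sub>R 0 + 1 *\<^sub>R e)) (at t)"
    by (intro derivative_intros)
  then show ?thesis
    by simp
qed

text \<open>The automorphy factor has logarithmic derivative tr(Q w) along the curve, which is the
  inhomogeneous term. Comparing values at t = 0 forces det J^\<beta> = 1 wherever f does not
  vanish.\<close>

lemma automorphic_form_derivative:
  fixes f :: "complex^2^2 \<Rightarrow> complex"
  assumes G: "G \<in> Sp4Z"
    and fixed: "block_A G ** sym_mat v + block_B G = sym_mat v ** (block_C G ** sym_mat v + block_D G)"
  defines "J \<equiv> block_C G ** sym_mat v + block_D G"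
  assumes f': "((f \<circ> sym_mat) has_derivative f') (at v)" and U: "open U" "v \<in> U"
    and inv: "\<And>u. u \<in> U \<Longrightarrow>
      f (siegel_act G (sym_mat u)) = det (block_C G ** sym_mat u + block_D G) powi \<beta> * f (sym_mat u)"
  shows "f' w = det J powi \<beta> * (of_int \<beta> * trace (block_C G ** transpose J ** sym_mat w) * f (sym_mat v) + f' (cong_act J w))"
    and "det J powi \<beta> * f (sym_mat v) = f (sym_mat v)"
proof -
  obtain n m where n: "n 0 = v" "(n has_vector_derivative w) (at 0)"
    and m: "m 0 = det J" "(m has_vector_derivative trace (block_C G ** transpose J ** sym_mat w) * det J) (at 0)" "det J \<noteq> 0"
    and ev: "\<forall>\<^sub>F t in nhds 0. det (block_C G ** sym_mat (v + t *\<^sub>R cong_act J w) + block_D G) = m t \<and>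
       siegel_act G (sym_mat (v + t *\<^sub>R cong_act J w)) = sym_mat (n t)"
    by (rule siegel_act_curve [OF G fixed, of w, folded J_def])
  from ev nhds_curve [OF U, of "cong_act J w"]
  have eq: "\<forall>\<^sub>F t in nhds 0. (f \<circ> sym_mat) (n t) = m t powi \<beta> * (f \<circ> sym_mat) (v + t *\<^sub>R cong_act J w)"
    by eventually_elim (use inv in force)
  from eventually_nhds_x_imp_x [OF this] show "det J powi \<beta> * f (sym_mat v) = f (sym_mat v)"
    by (simp add: n m)
  have 1: "((\<lambda>t. (f \<circ> sym_mat) (n t)) has_vector_derivative f' w) (at 0)"
    using has_vector_derivative_compose [of "f \<circ> sym_mat" f' n 0 w] f' n by simp
  have 2: "((\<lambda>t. (f \<circ> sym_mat) (v + t *\<^sub>R cong_act J w)) has_vector_derivative f' (cong_act J w)) (at 0)"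
    using has_vector_derivative_compose [of "f \<circ> sym_mat" f' "\<lambda>t. v + t *\<^sub>R cong_act J w" 0] f'
      has_vector_derivative_line [of v "cong_act J w" 0] by simp
  have "((\<lambda>z. z powi \<beta>) has_derivative (\<lambda>y. y * (of_int \<beta> * det J powi (\<beta> - 1)))) (at (m 0))"
    using has_derivative_power_int' [where x = "m 0" and n = \<beta> and S = UNIV] m by simp
  from has_vector_derivative_compose [OF this m(2)]
  have 3: "((\<lambda>t. m t powi \<beta>) has_vector_derivative
      det J powi \<beta> * (of_int \<beta> * trace (block_C G ** transpose J ** sym_mat w))) (at 0)"
    using m by (simp add: power_int_diff field_simps)
  show "f' w = det J powi \<beta> * (of_int \<beta> * trace (block_C G ** transpose J ** sym_mat w) * f (sym_mat v) + f' (cong_act J w))"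
    using has_vector_derivative_eventually_eq [OF 1 has_vector_derivative_mult [OF 3 2] eq]
    by (simp add: m algebra_simps)
qed


section \<open>The logarithmic differential of Y under the stabiliser\<close>

text \<open>The (1,0)-part of d log Y evaluated on w, complex linear in w; the factor 2 i comes from
  the derivative 1 / (2 i) of Im z with respect to z.\<close>

definition dlog_Y :: "complex^3 \<Rightarrow> complex^3 \<Rightarrow> complex" where
  "dlog_Y v w = (Im (v $ 2) * w $ 1 + Im (v $ 1) * w $ 2 - 2 * Im (v $ 3) * w $ 3) /
     (2 * \<i> * Y_fun (sym_mat v))"

definition cnj_mat :: "complex^'n^'m \<Rightarrow> complex^'n^'m" where
  "cnj_mat A = (\<chi> i j. cnj (A $ i $ j))"

lemma cnj_mat_mult: "cnj_mat (A ** B) = cnj_mat A ** cnj_mat B"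
  and cnj_mat_add: "cnj_mat (A + B') = cnj_mat A + cnj_mat B'"
  by (simp_all add: cnj_mat_def vec_eq_iff matrix_matrix_mult_def)

lemma cnj_mat_block:
  "cnj_mat (block_A G) = block_A G" "cnj_mat (block_B G) = block_B G"
  "cnj_mat (block_C G) = block_C G" "cnj_mat (block_D G) = block_D G"
  by (simp_all add: cnj_mat_def vec_eq_iff block_A_def block_B_def block_C_def block_D_def)

lemma mat_commute: "A ** mat c = mat c ** (A :: 'a::comm_semiring_1^'n^'n)"
  by (simp add: vec_eq_iff matrix_matrix_mult_def mat_def if_distrib [of "(*) _"]
      if_distrib [of "\<lambda>x. x * _"] mult.commute cong: if_cong)

lemma trace_mat_mult: "trace (mat c ** A) = c * trace (A :: 'a::comm_semiring_1^'n^'n)"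
  by (simp add: trace_def matrix_matrix_mult_def mat_def if_distrib [of "\<lambda>x. x * _"] sum_distrib_left cong: if_cong)

text \<open>
  The infinitesimal form of \<open>Y (G M) = Y M / |det (C M + D)|\<^sup>2\<close> at a fixed point. It is obtained from
  \<open>(A - cnj M C) (M - cnj M) = (M - cnj M) (C M + D)\<close>, which only uses that \<open>M\<close> and \<open>cnj M\<close> are fixed.
\<close>
lemma dlog_Y_cong_act:
  assumes G: "G \<in> Sp4Z"
    and fixed: "block_A G ** sym_mat v + block_B G = sym_mat v ** (block_C G ** sym_mat v + block_D G)"
    and Y: "Y_fun (sym_mat v) \<noteq> 0"
  defines "J \<equiv> block_C G ** sym_mat v + block_D G"
  shows "dlog_Y v (cong_act J w) = dlog_Y v w + trace (block_C G ** transpose J ** sym_mat w)"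
proof -
  let ?M = "sym_mat v" and ?f = "sym_mat w"
  define Q where "Q = block_C G ** transpose J"
  define D where "D = ?M - cnj_mat ?M"
  \<comment> \<open>The adjugate of D = 2 i Im M. Since det D = -4 Y, Jacobi's formula turns tr(adj
    D E) into the (1,0)-derivative of det D in the direction E, that is, \<open>\<delta>\<close>
    times \<open>dlog_Y\<close>.\<close>
  define Da where "Da = m2 (D $ 2 $ 2) (- (D $ 1 $ 2)) (- (D $ 1 $ 2)) (D $ 1 $ 1)"
  define P where "P = block_A G - cnj_mat ?M ** block_C G"
  define \<delta> where "\<delta> = complex_of_real (- 4 * Y_fun ?M)"
  have D: "D = m2 (2 * \<i> * Im (v $ 1)) (2 * \<i> * Im (v $ 3)) (2 * \<i> * Im (v $ 3)) (2 * \<i> * Im (v $ 2))"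
    by (simp add: D_def sym_mat_eq_m2 cnj_mat_def vec_eq_iff forall_2 complex_eq_iff)
  have DDa: "D ** Da = mat \<delta>" "Da ** D = mat \<delta>"
    by (simp_all add: Da_def D m2_simps \<delta>_def Y_fun_sym_mat vec_eq_iff forall_2 mat_def algebra_simps power2_eq_square)
  have tr: "trace (Da ** sym_mat u) = \<delta> * dlog_Y v u" for u
    using Y by (simp add: Da_def D sym_mat_eq_m2 m2_simps \<delta>_def dlog_Y_def field_simps)
  have "block_A G ** cnj_mat ?M + block_B G = cnj_mat ?M ** (block_C G ** cnj_mat ?M + block_D G)"
    using arg_cong [OF fixed, of cnj_mat] by (simp add: cnj_mat_add cnj_mat_mult cnj_mat_block)
  then have 2: "block_A G ** cnj_mat ?M = cnj_mat ?M ** block_C G ** cnj_mat ?M + cnj_mat ?M ** block_D G - block_B G"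
    by (simp add: matrix_add_ldistrib matrix_mul_assoc eq_diff_eq)
  have "block_A G ** ?M = ?M ** block_C G ** ?M + ?M ** block_D G - block_B G"
    using fixed by (simp add: matrix_add_ldistrib matrix_mul_assoc eq_diff_eq)
  with 2 have PD: "P ** D = D ** J"
    unfolding P_def D_def J_def
    by (simp add: matrix_diff_ldistrib matrix_diff_rdistrib matrix_add_ldistrib matrix_mul_assoc)
  have "?M ** Q + mat 1 = block_A G ** transpose J"
    using symplectic_fixed_point_relations(2) [OF Sp4Z_blocks [OF G] fixed transpose_sym_mat]
    by (simp add: Q_def J_def)
  then have PJ: "P ** transpose J = mat 1 + D ** Q"
    unfolding P_def D_def by (simp add: matrix_diff_rdistrib Q_def matrix_mul_assoc algebra_simps)
  \<comment> \<open>From J = D^(-1) P D and P J^T = 1 + D Q follows J adj D J^T = adj D + \<delta>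
    Q. Using the adjugate replaces D^(-1) by a scalar \<delta> on both sides, which is cancelled
    afterwards.\<close>
  have "mat \<delta> ** (J ** Da ** transpose J) = Da ** (D ** J) ** Da ** transpose J"
    by (simp add: matrix_mul_assoc DDa)
  also have "\<dots> = Da ** P ** (D ** Da) ** transpose J"
    by (simp add: matrix_mul_assoc flip: PD)
  also have "\<dots> = mat \<delta> ** (Da ** (P ** transpose J))"
    unfolding DDa mat_commute by (simp add: mat_commute flip: matrix_mul_assoc)
  also have "\<dots> = mat \<delta> ** (Da + mat \<delta> ** Q)"
    by (simp add: PJ matrix_add_ldistrib matrix_mul_assoc DDa)
  finally have "mat (inverse \<delta>) ** mat \<delta> ** (J ** Da ** transpose J) = mat (inverse \<delta>) ** mat \<delta> ** (Da + mat \<delta> ** Q)"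
    by (simp flip: matrix_mul_assoc)
  moreover have \<delta>0: "\<delta> \<noteq> 0"
    using Y by (simp add: \<delta>_def)
  then have "mat (inverse \<delta>) ** mat \<delta> = (mat 1 :: complex^2^2)"
    by (simp add: vec_eq_iff forall_2 mat_def matrix_matrix_mult_def sum_2)
  ultimately have JJ: "J ** Da ** transpose J = Da + mat \<delta> ** Q"
    by simp
  have "\<delta> * dlog_Y v (cong_act J w) = trace ((Da ** transpose J ** ?f) ** J)"
    by (simp add: sym_mat_cong_act matrix_mul_assoc flip: tr)
  also have "\<dots> = trace (J ** (Da ** transpose J ** ?f))"
    by (rule trace_mul_sym)
  also have "\<dots> = trace ((J ** Da ** transpose J) ** ?f)"
    by (simp add: matrix_mul_assoc)
  also have "\<dots> = \<delta> * (dlog_Y v w + trace (Q ** ?f))"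
    unfolding JJ
    by (simp add: matrix_add_rdistrib trace_add tr trace_mat_mult distrib_left flip: matrix_mul_assoc)
  finally show ?thesis
    using \<delta>0 by (simp add: Q_def)
qed

section \<open>The six elliptic fixed points\<close>

definition sp_block :: "int^2^2 \<Rightarrow> int^2^2 \<Rightarrow> int^2^2 \<Rightarrow> int^2^2 \<Rightarrow> int_block" where
  "sp_block A B C D = (\<chi> a b. case (a, b) of
      (Inl i, Inl j) \<Rightarrow> A $ i $ j | (Inl i, Inr j) \<Rightarrow> B $ i $ j
    | (Inr i, Inl j) \<Rightarrow> C $ i $ j | (Inr i, Inr j) \<Rightarrow> D $ i $ j)"

lemma block_sp_block:
  "block_A (sp_block (m2 a b c d) B C D) = m2 (of_int a) (of_int b) (of_int c) (of_int d)"
  "block_B (sp_block A (m2 a b c d) C D) = m2 (of_int a) (of_int b) (of_int c) (of_int d)"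
  "block_C (sp_block A B (m2 a b c d) D) = m2 (of_int a) (of_int b) (of_int c) (of_int d)"
  "block_D (sp_block A B C (m2 a b c d)) = m2 (of_int a) (of_int b) (of_int c) (of_int d)"
  by (simp_all add: block_A_def block_B_def block_C_def block_D_def sp_block_def vec_eq_iff forall_2)

definition regular_fixed_point :: "int_block \<Rightarrow> complex^2^2 \<Rightarrow> bool" where
  "regular_fixed_point G M \<longleftrightarrow> G \<in> Sp4Z \<and>
     block_A G ** M + block_B G = M ** (block_C G ** M + block_D G) \<and>
     det (block_C G ** M + block_D G) \<noteq> 1 \<and>
     (det (block_C G ** M + block_D G) + 1)\<^sup>2 \<noteq> (trace (block_C G ** M + block_D G))\<^sup>2"

lemma sigma_m2:
  "sigma1 = m2 zeta5 (zeta5 + zeta5 powi (-2)) (zeta5 + zeta5 powi (-2)) (- (zeta5 powi (-1)))"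
  "sigma2 = m2 eta ((eta - 1) / 2) ((eta - 1) / 2) eta"
  "sigma3 = m2 \<i> 0 0 \<i>"
  "sigma4 = m2 rho 0 0 rho"
  "sigma5 = m2 (\<i> / sqrt 3 * 2) (\<i> / sqrt 3) (\<i> / sqrt 3) (\<i> / sqrt 3 * 2)"
  "sigma6 = m2 rho 0 0 \<i>"
  by (simp_all add: sigma1_def sigma2_def sigma3_def sigma4_def sigma5_def sigma6_def vec_eq_iff forall_2)

lemma Sp4Z_sp_block: "sp_block A B C D \<in> Sp4Z \<longleftrightarrow>
   A ** transpose B = B ** transpose A \<and> C ** transpose D = D ** transpose C \<and>
   A ** transpose D = B ** transpose C + mat 1"
  unfolding Sp4Z_iff
  by (simp add: sp_block_def vec_eq_iff matrix_matrix_mult_def transpose_def mat_def diff_eq_eq add.commute)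

lemma zeta5_props: "zeta5 ^ 5 = 1" "zeta5 \<noteq> 1" "zeta5 \<noteq> 0"
proof -
  have "exp (2 * (\<i> * complex_of_real pi)) = 1"
    using exp_two_pi_i by (simp only: ac_simps)
  then show "zeta5 ^ 5 = 1"
    by (simp add: zeta5_def flip: exp_of_nat_mult)
  show "zeta5 \<noteq> 0"
    by (simp add: zeta5_def)
  have "0 < sin (2 * pi / 5)"
    by (rule sin_gt_zero) auto
  then have "Im zeta5 \<noteq> 0"
    by (simp add: zeta5_def Im_exp)
  then show "zeta5 \<noteq> 1"
    by auto
qed

lemma rho_props: "rho ^ 3 = 1" "rho \<noteq> 1"
proof -
  have "exp (2 * (\<i> * complex_of_real pi)) = 1"
    using exp_two_pi_i by (simp only: ac_simps)
  then show "rho ^ 3 = 1"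
    by (simp add: rho_def flip: exp_of_nat_mult)
  have "0 < sin (2 * pi / 3)"
    by (rule sin_gt_zero) auto
  then have "Im rho \<noteq> 0"
    by (simp add: rho_def Im_exp)
  then show "rho \<noteq> 1"
    by auto
qed

lemma rho_quadratic: "rho * rho = - rho - 1"
proof -
  have "(rho - 1) * (rho * rho + rho + 1) = 0"
    using rho_props(1) by (simp add: algebra_simps power3_eq_cube)
  then have "rho * rho + rho + 1 = 0"
    using rho_props(2) unfolding mult_eq_0_iff by simp
  then show ?thesis
    by algebra
qed

text \<open>With z = \<open>zeta5\<close>, J has determinant z^4 and trace -z - z^3, so its
  eigenvalues are -z and -z^3 and those of the congruence are z^2, z and z^4. Everything is reduced
  modulo the fifth cyclotomic polynomial.\<close>

lemma regular_fixed_point_sigma1: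
  "regular_fixed_point (sp_block (m2 0 0 (-1) 1) (m2 1 1 1 0) (m2 0 (-1) 0 0) (m2 0 0 (-1) 0)) sigma1"
proof -
  define z where "z = zeta5"
  note props = zeta5_props [folded z_def]
  have z5: "z * z * z * z * z = 1"
    using props(1) by (simp add: eval_nat_numeral mult.assoc)
  have "(z - 1) * (z^4 + z^3 + z^2 + z + 1) = 0"
    using z5 by (simp add: algebra_simps eval_nat_numeral)
  then have "z^4 + z^3 + z^2 + z + 1 = 0"
    using props(2) unfolding mult_eq_0_iff by simp
  then have cyc: "z^4 = - (z^3) - z^2 - z - 1"
    by algebra
  have powi: "z powi (-2) = z^3" "inverse z = z^4"
    using props(3) z5 by (simp_all add: power_int_minus field_simps eval_nat_numeral)
  have s: "sigma1 = m2 z (z + z^3) (z + z^3) (z^3 + z^2 + z + 1)"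
    by (simp add: sigma_m2 powi m2_eq_iff cyc flip: z_def)
  have "z \<noteq> -1"
    using props(1) by auto
  then have "z + 1 \<noteq> 0"
    by (simp add: eq_neg_iff_add_eq_0)
  then have "(z + 1) * ((z - 1) * (z - 1)) \<noteq> 0"
    using props(2) by simp
  \<comment> \<open>This is (l^2 - 1) (m^2 - 1) for l = -z and m = -z^3, that is, (z^2 - 1) (z -
    1).\<close>
  moreover have "(- (z ^ 3) - z\<^sup>2 - z)\<^sup>2 - (- z - z ^ 3)\<^sup>2 = (z + 1) * ((z - 1) * (z - 1))"
    using cyc by algebra
  ultimately have tr: "(- (z ^ 3) - z\<^sup>2 - z)\<^sup>2 \<noteq> (- z - z ^ 3)\<^sup>2"
    by auto
  have eqs: "z * (- z - z ^ 3) + (- z - z ^ 3) = 1" "z * (- (z ^ 3) - z\<^sup>2 - z - 1) = 1"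
    "2 + 2 * z ^ 3 = (z + z ^ 3) * (- z - z ^ 3) + (- z - z\<^sup>2)"
    "z\<^sup>2 + 1 = (z + z ^ 3) * (- (z ^ 3) - z\<^sup>2 - z - 1)"
    using cyc by algebra+
  have "z^4 \<noteq> 1"
  proof
    assume "z^4 = 1"
    moreover have "z^5 = z * z^4"
      by (simp add: eval_nat_numeral)
    ultimately show False
      using props by simp
  qed
  then show ?thesis
    unfolding regular_fixed_point_def Sp4Z_sp_block block_sp_block s
    using cyc by (simp add: m2_simps tr) (use eqs in blast)
qed

text \<open>\<open>eta\<close> is a root of 3 x^2 - 2 x + 3. Here J has determinant -1 and trace -i
  sqrt 2, so its eigenvalues are primitive eighth roots of unity and those of the congruence are i,
  -i and -1.\<close>

lemma regular_fixed_point_sigma2: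
  "regular_fixed_point (sp_block (m2 (-1) 0 0 0) (m2 1 0 0 1) (m2 (-1) 0 1 (-1)) (m2 0 (-1) (-1) 1)) sigma2"
proof -
  have e: "eta * eta = (2 * eta - 3) / 3"
    by (simp add: eta_def complex_eq_iff field_simps)
  have "eta * 6 = 9 + eta * (eta * 9)"
    by (simp add: mult.assoc [symmetric] e) (simp add: field_simps)
  then have "eta * 6 \<noteq> 1 + eta * (eta * 9)"
    by simp
  then show ?thesis
    unfolding regular_fixed_point_def Sp4Z_sp_block block_sp_block sigma_m2
    by (simp add: m2_simps) (simp add: field_simps e power2_eq_square)
qed

text \<open>The inversion M -> -M^(-1): J = -i, so the congruence is multiplication by -1.\<close>

lemma regular_fixed_point_sigma3:
  "regular_fixed_point (sp_block (m2 0 0 0 0) (m2 1 0 0 1) (m2 (-1) 0 0 (-1)) (m2 0 0 0 0)) sigma3"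
  unfolding regular_fixed_point_def Sp4Z_sp_block block_sp_block sigma_m2
  by (simp add: m2_simps power2_eq_square)

text \<open>J has trace 0 and determinant -rho - 1 = rho^2, so the congruence has the eigenvalues
  rho^2 and, twice, -rho^2.\<close>

lemma regular_fixed_point_sigma4:
  "regular_fixed_point (sp_block (m2 0 0 (-1) 0) (m2 0 1 0 0) (m2 0 (-1) 0 0) (m2 0 (-1) (-1) 0)) sigma4"
proof -
  have "- rho \<noteq> 2"
  proof
    assume "- rho = 2"
    then have "rho = -2"
      by (metis add.inverse_inverse)
    from rho_quadratic [unfolded this] show False
      by simp
  qed
  moreover have "- rho \<noteq> 1"
  proof
    assume "- rho = 1"
    then have "rho = -1"
      by (metis add.inverse_inverse)
    from rho_quadratic [unfolded this] show False
      by simp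
  qed
  ultimately show ?thesis
    unfolding regular_fixed_point_def Sp4Z_sp_block block_sp_block sigma_m2
    by (auto simp: m2_simps power2_eq_square rho_quadratic algebra_simps minus_equation_iff)
qed

text \<open>J has determinant -1 and trace -i sqrt 3; the congruence has the eigenvalues rho, rho^2
  and -1.\<close>

lemma regular_fixed_point_sigma5:
  "regular_fixed_point (sp_block (m2 0 0 0 0) (m2 1 1 0 1) (m2 (-1) 0 1 (-1)) (m2 0 0 0 0)) sigma5"
proof -
  define k where "k = \<i> / sqrt 3"
  have k: "k * k = - 1 / 3"
    by (simp add: k_def complex_eq_iff)
  then have kk: "k * (k * x) = - x / 3" for x
    by (simp flip: mult.assoc)
  show ?thesis
    unfolding regular_fixed_point_def Sp4Z_sp_block block_sp_block sigma_m2 k_def [symmetric]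
    by (simp add: m2_simps power2_eq_square k kk algebra_simps)
qed

text \<open>The elliptic maps -1 / (T + 1) and -1 / U on the two diagonal factors: J = diag(rho^2,
  -i), and the congruence has the eigenvalues rho, -1 and -i rho^2.\<close>

lemma regular_fixed_point_sigma6:
  "regular_fixed_point (sp_block (m2 0 0 0 0) (m2 1 0 0 1) (m2 (-1) 0 0 (-1)) (m2 (-1) 0 0 0)) sigma6"
proof -
  have "\<i> + \<i> * rho \<noteq> 1"
  proof
    assume "\<i> + \<i> * rho = 1"
    then have "\<i> * (\<i> + \<i> * rho) = \<i>"
      by simp
    then have "rho = - 1 - \<i>"
      by (simp add: algebra_simps) (metis add.inverse_inverse add.commute minus_diff_eq diff_eq_eq)
    then show False
      using rho_quadratic by (simp add: complex_eq_iff)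
  qed
  then show ?thesis
    using rho_props(2)
    unfolding regular_fixed_point_def Sp4Z_sp_block block_sp_block sigma_m2
    by (simp add: m2_simps power2_eq_square rho_quadratic algebra_simps)
qed


lemma regular_fixed_point_exists:
  assumes "M \<in> {sigma1, sigma2, sigma3, sigma4, sigma5, sigma6}"
  shows "\<exists>G. regular_fixed_point G M"
  using assms regular_fixed_point_sigma1 regular_fixed_point_sigma2 regular_fixed_point_sigma3
    regular_fixed_point_sigma4 regular_fixed_point_sigma5 regular_fixed_point_sigma6 by blast

section \<open>Invariant covectors at a fixed point\<close>

lemma complex_linear_form_expand:
  fixes f :: "complex^3 \<Rightarrow> complex"
  assumes "linear f" "\<And>c v. f (c *s v) = c * f v"
  shows "f w = f (axis 1 1) * w $ 1 + f (axis 2 1) * w $ 2 + f (axis 3 1) * w $ 3"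
proof -
  have "w = w $ 1 *s axis 1 1 + w $ 2 *s axis 2 1 + w $ 3 *s axis 3 1"
    by (simp add: vec_eq_iff forall_3 axis_def)
  then have "f w = f (w $ 1 *s axis 1 1 + w $ 2 *s axis 2 1 + w $ 3 *s axis 3 1)"
    by simp
  then show ?thesis
    by (simp add: linear_add [OF assms(1)] assms(2) mult.commute)
qed

lemma fixed_point_invariant_form_zero:
  assumes "regular_fixed_point G (sym_mat v)"
    and "linear f" "\<And>c w. f (c *s w) = c * f w"
    and inv: "\<And>w. f w = f (cong_act (block_C G ** sym_mat v + block_D G) w)"
  shows "f w = 0"
proof -
  let ?J = "block_C G ** sym_mat v + block_D G"
  have ex: "f u = f (axis 1 1) * u $ 1 + f (axis 2 1) * u $ 2 + f (axis 3 1) * u $ 3" for u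
    using complex_linear_form_expand assms(2,3) by blast
  have "f (axis 1 1) = 0 \<and> f (axis 2 1) = 0 \<and> f (axis 3 1) = 0"
  proof (rule cong_act_invariant_form_zero)
    fix u
    show "f (axis 1 1) * u $ 1 + f (axis 2 1) * u $ 2 + f (axis 3 1) * u $ 3 =
      f (axis 1 1) * cong_act ?J u $ 1 + f (axis 2 1) * cong_act ?J u $ 2 + f (axis 3 1) * cong_act ?J u $ 3"
      using inv [of u] unfolding ex [of u] ex [of "cong_act ?J u"] .
  qed (use assms(1) in \<open>auto simp: regular_fixed_point_def\<close>)
  then show ?thesis
    unfolding ex [of w] by simp
qed

lemma scaleR_eq_smult: "r *\<^sub>R w = complex_of_real r *s w"
  by (simp add: vec_eq_iff) (simp add: scaleR_conv_of_real)

lemma dlog_Y_scale: "dlog_Y v (c *s w) = c * dlog_Y v w"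
  by (simp add: dlog_Y_def algebra_simps)

lemma linear_dlog_Y: "linear (dlog_Y v)"
proof (rule linearI)
  show "dlog_Y v (a + b) = dlog_Y v a + dlog_Y v b" for a b
    by (simp add: dlog_Y_def add_divide_distrib [symmetric] algebra_simps)
  show "dlog_Y v (r *\<^sub>R a) = r *\<^sub>R dlog_Y v a" for r a
    unfolding scaleR_eq_smult dlog_Y_scale scaleR_conv_of_real ..
qed

text \<open>The trace term in the law for \<open>f'\<close> cancels against the one in the law for
  \<open>dlog_Y\<close>, because det J^\<beta> = 1. The alternative in the last hypothesis lets one
  statement serve both chi, with a nonzero value, and the weight 0 function H, whose value may
  vanish.\<close>

lemma dlog_automorphic_form_fixed_point:
  fixes f :: "complex^2^2 \<Rightarrow> complex"
  assumes reg: "regular_fixed_point G (sym_mat v)" and Y: "Y_fun (sym_mat v) \<noteq> 0"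
    and f': "((f \<circ> sym_mat) has_derivative f') (at v)" "\<And>c w. f' (c *s w) = c * f' w"
    and U: "open U" "v \<in> U"
    and inv: "\<And>u. u \<in> U \<Longrightarrow>
      f (siegel_act G (sym_mat u)) = det (block_C G ** sym_mat u + block_D G) powi \<beta> * f (sym_mat u)"
    and nz: "f (sym_mat v) \<noteq> 0 \<or> \<beta> = 0"
  shows "f' w + of_int \<beta> * f (sym_mat v) * dlog_Y v w = 0"
proof (rule fixed_point_invariant_form_zero [OF reg])
  have G: "G \<in> Sp4Z"
    and fixed: "block_A G ** sym_mat v + block_B G = sym_mat v ** (block_C G ** sym_mat v + block_D G)"
    using reg by (auto simp: regular_fixed_point_def)
  have lin: "linear f'"
    using f'(1) by (rule has_derivative_linear)
  show sc: "f' (c *s w) + of_int \<beta> * f (sym_mat v) * dlog_Y v (c *s w) =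
      c * (f' w + of_int \<beta> * f (sym_mat v) * dlog_Y v w)" for c w
    by (simp add: f' dlog_Y_scale algebra_simps)
  show "linear (\<lambda>w. f' w + of_int \<beta> * f (sym_mat v) * dlog_Y v w)"
  proof (rule linearI)
    fix a b and r :: real
    show "f' (a + b) + of_int \<beta> * f (sym_mat v) * dlog_Y v (a + b) =
        f' a + of_int \<beta> * f (sym_mat v) * dlog_Y v a + (f' b + of_int \<beta> * f (sym_mat v) * dlog_Y v b)"
      by (simp add: linear_add [OF lin] linear_add [OF linear_dlog_Y] algebra_simps)
    show "f' (r *\<^sub>R a) + of_int \<beta> * f (sym_mat v) * dlog_Y v (r *\<^sub>R a) =
        r *\<^sub>R (f' a + of_int \<beta> * f (sym_mat v) * dlog_Y v a)"
      unfolding scaleR_eq_smult sc scaleR_conv_of_real ..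
  qed
  fix w
  define J where "J = block_C G ** sym_mat v + block_D G"
  have "det J powi \<beta> = 1"
    using automorphic_form_derivative(2) [OF G fixed f'(1) U inv] nz by (auto simp: J_def)
  then show "f' w + of_int \<beta> * f (sym_mat v) * dlog_Y v w =
      f' (cong_act (block_C G ** sym_mat v + block_D G) w)
      + of_int \<beta> * f (sym_mat v) * dlog_Y v (cong_act (block_C G ** sym_mat v + block_D G) w)"
    using automorphic_form_derivative(1) [OF G fixed f'(1) U inv, of w] dlog_Y_cong_act [OF G fixed Y, of w]
    by (simp add: J_def algebra_simps)
qed

section \<open>Derivatives at the fixed point\<close>

lemma norm_smult: "norm (c *s (v :: complex^'n::finite)) = norm c * norm v"
  by (simp add: norm_vec_def L2_set_def norm_mult power_mult_distrib real_sqrt_mult flip: sum_distrib_left)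

lemma bounded_linear_smult: "bounded_linear (\<lambda>c. c *s (v :: complex^'n::finite))"
  by (rule bounded_linear_intro [where K = "norm v"])
     (simp_all add: norm_smult scaleR_eq_smult vec_eq_iff algebra_simps scaleR_conv_of_real)

lemma cauchy_derivative_bound:
  fixes f :: "complex \<Rightarrow> complex"
  assumes f': "\<And>w. w \<in> cball z r \<Longrightarrow> (f has_field_derivative f' w) (at w)" and "0 < r"
    and B: "\<And>w. w \<in> cball z r \<Longrightarrow> norm (f w) \<le> B"
  shows "norm (f' z) \<le> B / r"
proof -
  have "f holomorphic_on ball z r"
    unfolding holomorphic_on_def
    by (meson f' ball_subset_cball subsetD field_differentiable_at_within field_differentiable_def)
  moreover have "continuous_on (cball z r) f"
    by (intro continuous_at_imp_continuous_on ballI) (meson f' DERIV_isCont)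
  ultimately have "norm ((deriv ^^ 1) f z) \<le> fact 1 * B / r ^ 1"
    using \<open>0 < r\<close> B by (intro Cauchy_inequality) (auto simp: dist_norm)
  then show ?thesis
    using DERIV_imp_deriv [OF f' [of z]] \<open>0 < r\<close> by simp
qed

text \<open>
  Holomorphy here is plain complex differentiability, with no continuity of the derivative. Cauchy's
  estimate in the direction \<open>e\<close> bounds \<open>h (v + s d + \<tau> e) - h (v + s d)\<close> by \<open>C |\<tau>|\<close> uniformly in \<open>s\<close>;
  Cauchy's estimate in \<open>s\<close> then bounds its \<open>s\<close>-derivative.
\<close>
lemma holomorphic_sv_derivative_lipschitz:
  fixes h :: "complex^'n::finite \<Rightarrow> complex"
  assumes U: "open U" "v \<in> U"
    and h': "\<And>u. u \<in> U \<Longrightarrow> (h has_derivative h' u) (at u)"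
    and lin: "\<And>u c w. u \<in> U \<Longrightarrow> h' u (c *s w) = c * h' u w"
  obtains C \<delta> where "0 < \<delta>" "\<And>\<tau>. norm \<tau> \<le> \<delta> \<Longrightarrow> norm (h' (v + \<tau> *s e) d - h' v d) \<le> C * norm \<tau>"
proof -
  obtain R where R: "0 < R" "cball v R \<subseteq> U"
    using U by (meson open_contains_cball)
  have "continuous_on (cball v R) h"
    by (intro continuous_at_imp_continuous_on ballI)
       (metis R(2) h' has_derivative_continuous subsetD)
  then have "bounded (h ` cball v R)"
    by (intro compact_imp_bounded compact_continuous_image) auto
  then obtain B where B: "\<And>u. u \<in> cball v R \<Longrightarrow> norm (h u) \<le> B"
    unfolding bounded_iff by blast
  \<comment> \<open>Scaled so that s d + \<tau> e stays in the ball of radius R for |s|, |\<tau>| at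
    most r; the summand 1 keeps the denominator positive when d = e = 0.\<close>
  define r where "r = R / (1 + norm d + norm e)"
  have pos: "1 + norm d + norm e > 0"
    by (simp add: add_pos_nonneg)
  have "0 < r"
    unfolding r_def using R(1) pos by simp
  have rR: "r * norm d + r * norm e \<le> R"
  proof -
    have "r * (1 + norm d + norm e) = R"
      using pos by (simp add: r_def)
    then show ?thesis
      using \<open>0 < r\<close> by (simp add: algebra_simps)
  qed
  have inb: "v + s *s d + \<tau> *s e \<in> cball v R" if "norm s \<le> r" "norm \<tau> \<le> r" for s \<tau>
  proof -
    have "norm (s *s d + \<tau> *s e) \<le> norm s * norm d + norm \<tau> * norm e"
      by (metis norm_smult norm_triangle_ineq)
    also have "\<dots> \<le> r * norm d + r * norm e"
      using that by (intro add_mono mult_right_mono) auto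
    also note rR
    finally have "norm (s *s d + \<tau> *s e) \<le> R" .
    moreover have "dist v (v + (s *s d + \<tau> *s e)) = norm (s *s d + \<tau> *s e)"
      unfolding dist_norm by (metis add_diff_cancel_left' norm_minus_commute)
    ultimately show ?thesis
      unfolding mem_cball add.assoc by argo
  qed
  define g where "g s \<tau> = h (v + s *s d + \<tau> *s e)" for s \<tau>
  have g\<tau>: "((\<lambda>\<tau>. g s \<tau>) has_field_derivative h' (v + s *s d + \<tau> *s e) e) (at \<tau>)"
    if "norm s \<le> r" "norm \<tau> \<le> r" for s \<tau>
  proof -
    have u: "v + s *s d + \<tau> *s e \<in> U"
      using inb [OF that] R by blast
    have "((\<lambda>\<tau>. v + s *s d + \<tau> *s e) has_derivative (\<lambda>x. x *s e)) (at \<tau>)"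
      using has_derivative_add [OF has_derivative_const bounded_linear_imp_has_derivative [OF bounded_linear_smult]]
      by simp
    from has_derivative_compose [OF this h' [OF u]] show ?thesis
      unfolding g_def has_field_derivative_def by (simp add: lin [OF u] mult_commute_abs)
  qed
  have gs: "((\<lambda>s. g s \<tau>) has_field_derivative h' (v + s *s d + \<tau> *s e) d) (at s)"
    if "norm s \<le> r" "norm \<tau> \<le> r" for s \<tau>
  proof -
    have u: "v + s *s d + \<tau> *s e \<in> U"
      using inb [OF that] R by blast
    have "((\<lambda>s. (v + \<tau> *s e) + s *s d) has_derivative (\<lambda>x. x *s d)) (at s)"
      using has_derivative_add [OF has_derivative_const bounded_linear_imp_has_derivative [OF bounded_linear_smult]]
      by simp
    then have "((\<lambda>s. v + s *s d + \<tau> *s e) has_derivative (\<lambda>x. x *s d)) (at s)"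
      by (simp add: algebra_simps)
    from has_derivative_compose [OF this h' [OF u]] show ?thesis
      unfolding g_def has_field_derivative_def by (simp add: lin [OF u] mult_commute_abs)
  qed
  have gB: "norm (g s \<tau>) \<le> B" if "norm s \<le> r" "norm \<tau> \<le> r" for s \<tau>
    using B inb [OF that] by (simp add: g_def)
  \<comment> \<open>Every Cauchy disc has radius r / 2 and a centre within r / 2 of the origin, so
    it stays in the range where \<open>g\<close> is bounded by \<open>B\<close>.\<close>
  define C where "C = B / (r / 2)"
  have near: "norm w \<le> r" if "norm z \<le> r / 2" "w \<in> cball z (r / 2)" for w z :: complex
  proof -
    have "norm w \<le> norm z + norm (w - z)"
      by (metis add.commute diff_add_cancel norm_triangle_ineq)
    then show ?thesis
      using that by (simp add: dist_norm norm_minus_commute)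
  qed
  have 1: "norm (g s \<tau> - g s 0) \<le> C * norm \<tau>" if "norm s \<le> r" "norm \<tau> \<le> r / 2" for s \<tau>
  proof -
    have "norm (g s \<tau> - g s 0) \<le> C * norm (\<tau> - 0)"
    proof (rule field_differentiable_bound)
      show "convex (cball (0::complex) (r / 2))"
        by (rule convex_cball)
      fix z :: complex assume z: "z \<in> cball 0 (r / 2)"
      have zr: "norm z \<le> r / 2"
        using z by simp
      then have "norm z \<le> r"
        using \<open>0 < r\<close> by linarith
      from has_field_derivative_at_within [OF g\<tau> [OF that(1) this]]
      show "((\<lambda>\<tau>. g s \<tau>) has_field_derivative h' (v + s *s d + z *s e) e) (at z within cball 0 (r / 2))" .
      show "norm (h' (v + s *s d + z *s e) e) \<le> C"
        unfolding C_def
      proof (rule cauchy_derivative_bound [where f = "g s" and f' = "\<lambda>\<tau>. h' (v + s *s d + \<tau> *s e) e"])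
        fix w assume "w \<in> cball z (r / 2)"
        then have "norm w \<le> r"
          by (rule near [OF zr])
        then show "(g s has_field_derivative h' (v + s *s d + w *s e) e) (at w)" "norm (g s w) \<le> B"
          using g\<tau> [OF that(1)] gB [OF that(1)] by blast+
      qed (use \<open>0 < r\<close> in simp)
    qed (use that \<open>0 < r\<close> in auto)
    then show ?thesis
      by simp
  qed
  show thesis
  proof (rule that [of "r / 2" "C / (r / 2)"])
    show "0 < r / 2"
      using \<open>0 < r\<close> by simp
    fix \<tau> :: complex assume \<tau>: "norm \<tau> \<le> r / 2"
    have "norm (h' (v + 0 *s d + \<tau> *s e) d - h' (v + 0 *s d + 0 *s e) d) \<le> (C * norm \<tau>) / (r / 2)"
    proof (rule cauchy_derivative_bound [where f = "\<lambda>s. g s \<tau> - g s 0" and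
          f' = "\<lambda>s. h' (v + s *s d + \<tau> *s e) d - h' (v + s *s d + 0 *s e) d"])
      fix s :: complex assume "s \<in> cball 0 (r / 2)"
      then have s: "norm s \<le> r"
        using \<open>0 < r\<close> by simp
      have "norm \<tau> \<le> r" "norm (0::complex) \<le> r"
        using \<tau> \<open>0 < r\<close> by simp_all
      then show "((\<lambda>s. g s \<tau> - g s 0) has_field_derivative
          h' (v + s *s d + \<tau> *s e) d - h' (v + s *s d + 0 *s e) d) (at s)"
        using s by (intro DERIV_diff gs)
      show "norm (g s \<tau> - g s 0) \<le> C * norm \<tau>"
        using s \<tau> by (rule 1)
    qed (use \<open>0 < r\<close> in simp)
    then show "norm (h' (v + \<tau> *s e) d - h' v d) \<le> C / (r / 2) * norm \<tau>"
      by (simp add: algebra_simps)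
  qed
qed

lemma Re_dlog_Y:
  "Re (dlog_Y v w) = (Im (v $ 2) * Im (w $ 1) + Im (v $ 1) * Im (w $ 2) - 2 * Im (v $ 3) * Im (w $ 3)) /
     (2 * Y_fun (sym_mat v))"
proof -
  have "n / (2 * \<i> * of_real y) = - \<i> * n / of_real (2 * y)" for n y
    by (cases "y = 0") (simp_all add: divide_simps)
  then show ?thesis
    unfolding dlog_Y_def by (simp only: Re_divide_of_real) (simp add: algebra_simps)
qed

lemma Im_line: "Im ((v + t *\<^sub>R e) $ k) = Im (v $ k) + t * Im (e $ k)"
  by simp

lemma has_real_derivative_Y_line:
  assumes "Y_fun (sym_mat v) \<noteq> 0"
  shows "((\<lambda>t. Y_fun (sym_mat (v + t *\<^sub>R e))) has_real_derivative
     2 * Y_fun (sym_mat v) * Re (dlog_Y v e)) (at 0)"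
proof -
  have "2 * Y_fun (sym_mat v) * Re (dlog_Y v e) =
      Im (v $ 2) * Im (e $ 1) + Im (v $ 1) * Im (e $ 2) - 2 * Im (v $ 3) * Im (e $ 3)"
    using assms by (simp add: Re_dlog_Y)
  then show ?thesis
    unfolding Y_fun_sym_mat Im_line by (auto intro!: derivative_eq_intros simp: algebra_simps)
qed

definition kaehler_norm :: "real \<Rightarrow> (complex^3 \<Rightarrow> complex) \<Rightarrow> complex^3 \<Rightarrow> real" where
  "kaehler_norm \<gamma> h v = exp (- \<gamma> * ln (Y_fun (sym_mat v))) * (norm (h v))\<^sup>2"

lemma has_real_derivative_norm_power2:
  fixes f :: "real \<Rightarrow> complex"
  assumes "(f has_vector_derivative D) (at t)"
  shows "((\<lambda>t. (norm (f t))\<^sup>2) has_real_derivative 2 * Re (cnj (f t) * D)) (at t)"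
  unfolding cmod_power2 using assms by (auto intro!: derivative_eq_intros simp: algebra_simps)

text \<open>The derivative is 2 Y^(-\<gamma>) Re (cnj h (h' - \<gamma> h dlog_Y)) in the direction
  e, so the covariant derivative of h is a factor; no logarithm of h is taken, and h may
  vanish.\<close>

lemma kaehler_norm_stationary:
  assumes Y: "Y_fun (sym_mat v) > 0" and h': "(h has_derivative h') (at v)"
    and F: "h' e = \<gamma> * h v * dlog_Y v e"
  shows "((\<lambda>t. kaehler_norm \<gamma> h (v + t *\<^sub>R e)) has_real_derivative 0) (at 0)"
proof -
  have "((\<lambda>t. h (v + t *\<^sub>R e)) has_vector_derivative h' e) (at 0)"
    using has_vector_derivative_compose [of h h' "\<lambda>t. v + t *\<^sub>R e" 0] h' has_vector_derivative_line [of v e 0]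
    by simp
  note n' = has_real_derivative_norm_power2 [OF this]
  have "2 * Re (cnj (h v) * h' e) = 2 * \<gamma> * (norm (h v))\<^sup>2 * Re (dlog_Y v e)"
    unfolding F cmod_power2 by (simp add: algebra_simps power2_eq_square)
  then have n: "((\<lambda>t. (norm (h (v + t *\<^sub>R e)))\<^sup>2) has_real_derivative 2 * \<gamma> * (norm (h v))\<^sup>2 * Re (dlog_Y v e)) (at 0)"
    using n' by simp
  have y: "((\<lambda>t. Y_fun (sym_mat (v + t *\<^sub>R e))) has_real_derivative
     2 * Y_fun (sym_mat v) * Re (dlog_Y v e)) (at 0)"
    using Y by (intro has_real_derivative_Y_line) simp
  have "((\<lambda>t. ln (Y_fun (sym_mat (v + t *\<^sub>R e)))) has_real_derivative 2 * Re (dlog_Y v e)) (at 0)"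
    using DERIV_chain2 [OF DERIV_ln_divide y] Y by simp
  then have "((\<lambda>t. exp (- \<gamma> * ln (Y_fun (sym_mat (v + t *\<^sub>R e))))) has_real_derivative
      exp (- \<gamma> * ln (Y_fun (sym_mat (v + 0 *\<^sub>R e)))) * (- \<gamma> * (2 * Re (dlog_Y v e)))) (at 0)"
    by (intro DERIV_fun_exp DERIV_cmult)
  from DERIV_mult [OF this n] show ?thesis
    unfolding kaehler_norm_def by (simp add: algebra_simps)
qed

section \<open>First-order vanishing of the F-terms along lines\<close>

text \<open>A Lipschitz condition at 0 in place of differentiability: this is what the Cauchy
  estimate yields for the derivative of a holomorphic function, and it suffices for products of two
  such curves.\<close>

definition vanishes_linearly :: "(real \<Rightarrow> 'a::real_normed_vector) \<Rightarrow> bool" where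
  "vanishes_linearly f \<longleftrightarrow> f 0 = 0 \<and> (\<exists>C. \<forall>\<^sub>F t in at 0. norm (f t) \<le> C * \<bar>t\<bar>)"

lemma vanishes_linearly_diff:
  assumes "vanishes_linearly f" "vanishes_linearly g"
  shows "vanishes_linearly (\<lambda>t. f t - g t)"
proof -
  obtain C D where "\<forall>\<^sub>F t in at 0. norm (f t) \<le> C * \<bar>t\<bar>" "\<forall>\<^sub>F t in at 0. norm (g t) \<le> D * \<bar>t\<bar>"
    using assms by (auto simp: vanishes_linearly_def)
  then have "\<forall>\<^sub>F t in at 0. norm (f t - g t) \<le> (C + D) * \<bar>t\<bar>"
  proof eventually_elim
    case (elim t)
    then show ?case
      using norm_triangle_ineq4 [of "f t" "g t"] by (simp add: algebra_simps)
  qed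
  then show ?thesis
    using assms by (auto simp: vanishes_linearly_def)
qed

lemma vanishes_linearly_differentiable:
  fixes f :: "real \<Rightarrow> 'a::real_normed_vector"
  assumes "f differentiable (at 0)"
  shows "vanishes_linearly (\<lambda>t. f t - f 0)"
proof -
  obtain D where "(f has_vector_derivative D) (at 0)"
    using assms vector_derivative_works by blast
  then have "((\<lambda>t. norm (f t - f 0 - t *\<^sub>R D) / norm t) \<longlongrightarrow> 0) (at 0)"
    by (simp add: has_vector_derivative_def has_derivative_at)
  then have "\<forall>\<^sub>F t in at 0. norm (f t - f 0 - t *\<^sub>R D) / norm t < 1"
    by (rule order_tendstoD) simp
  moreover have "\<forall>\<^sub>F t in at (0::real). t \<noteq> 0"
    by (simp add: eventually_at_filter)
  ultimately have "\<forall>\<^sub>F t in at 0. norm (f t - f 0) \<le> (1 + norm D) * \<bar>t\<bar>"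
  proof eventually_elim
    case (elim t)
    then have "norm (f t - f 0 - t *\<^sub>R D) \<le> \<bar>t\<bar>"
      by (simp add: divide_simps)
    then show ?case
      using norm_triangle_ineq [of "f t - f 0 - t *\<^sub>R D" "t *\<^sub>R D"] by (simp add: algebra_simps)
  qed
  then show ?thesis
    by (auto simp: vanishes_linearly_def)
qed

text \<open>The product of two O(t) curves is O(t^2), and a factor continuous at 0 is bounded near
  0, so the difference quotient tends to 0.\<close>

lemma vanishes_linearly_product_derivative:
  fixes f g :: "real \<Rightarrow> complex" and c :: "real \<Rightarrow> real"
  assumes f: "vanishes_linearly f" and g: "vanishes_linearly g" and c: "isCont c 0"
  shows "((\<lambda>t. c t * Re (f t * cnj (g t))) has_real_derivative 0) (at 0)"
proof -
  obtain C D where CD: "\<forall>\<^sub>F t in at 0. norm (f t) \<le> C * \<bar>t\<bar>" "\<forall>\<^sub>F t in at 0. norm (g t) \<le> D * \<bar>t\<bar>"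
    using f g by (auto simp: vanishes_linearly_def)
  have 1: "\<forall>\<^sub>F t in at 0. norm ((c t * Re (f t * cnj (g t)) - c 0 * Re (f 0 * cnj (g 0))) / (t - 0)) \<le> \<bar>c t\<bar> * (C * (D * \<bar>t\<bar>))"
    using CD
  proof eventually_elim
    case (elim t)
    define R where "R = Re (f t * cnj (g t))"
    have "\<bar>R\<bar> \<le> norm (f t) * norm (g t)"
      unfolding R_def by (metis abs_Re_le_cmod complex_mod_cnj norm_mult)
    also have "\<dots> \<le> (C * \<bar>t\<bar>) * (D * \<bar>t\<bar>)"
      using elim by (intro mult_mono) (auto intro: order_trans [OF norm_ge_zero])
    finally have "\<bar>c t\<bar> * \<bar>R\<bar> / \<bar>t\<bar> \<le> \<bar>c t\<bar> * ((C * \<bar>t\<bar>) * (D * \<bar>t\<bar>)) / \<bar>t\<bar>"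
      by (intro divide_right_mono mult_left_mono) auto
    also have "\<dots> = \<bar>c t\<bar> * (C * (D * \<bar>t\<bar>))"
      by simp
    finally show ?case
      unfolding R_def [symmetric] using f by (simp add: vanishes_linearly_def abs_mult)
  qed
  have "((\<lambda>t. \<bar>c t\<bar> * (C * (D * \<bar>t\<bar>))) \<longlongrightarrow> \<bar>c 0\<bar> * (C * (D * \<bar>0\<bar>))) (at 0)"
    using c by (intro tendsto_intros) (simp_all add: isCont_def)
  then have "((\<lambda>t. \<bar>c t\<bar> * (C * (D * \<bar>t\<bar>))) \<longlongrightarrow> 0) (at 0)"
    by simp
  from Lim_null_comparison [OF 1 this] show ?thesis
    by (simp add: has_field_derivative_iff)
qed

text \<open>The covariant derivative of \<open>h\<close> for the Hermitian metric Y^(-\<gamma>);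
  multiplied by \<Omega> it gives the F-terms of T, U, Z.\<close>

definition moduli_F_term ::
    "real \<Rightarrow> (complex^3 \<Rightarrow> complex) \<Rightarrow> (complex^3 \<Rightarrow> complex^3 \<Rightarrow> complex) \<Rightarrow> complex^3 \<Rightarrow> complex^3 \<Rightarrow> complex" where
  "moduli_F_term \<gamma> h h' v w = h' v w - \<gamma> * h v * dlog_Y v w"

text \<open>The term \<open>h'\<close> is controlled by the Cauchy estimate, the term with
  \<open>dlog_Y\<close> is differentiable. Each minus its value at 0 is O(t), and the two values
  cancel because the F-term vanishes at v.\<close>

lemma moduli_F_term_vanishes_linearly:
  fixes h :: "complex^3 \<Rightarrow> complex"
  assumes U: "open U" "v \<in> U"
    and h': "\<And>u. u \<in> U \<Longrightarrow> (h has_derivative h' u) (at u)"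
    and lin: "\<And>u c w. u \<in> U \<Longrightarrow> h' u (c *s w) = c * h' u w"
    and Y: "Y_fun (sym_mat v) > 0" and F: "moduli_F_term \<gamma> h h' v d = 0"
  shows "vanishes_linearly (\<lambda>t. moduli_F_term \<gamma> h h' (v + t *\<^sub>R e) d)"
proof -
  obtain C \<delta> where \<delta>: "0 < \<delta>" "\<And>\<tau>. norm \<tau> \<le> \<delta> \<Longrightarrow> norm (h' (v + \<tau> *s e) d - h' v d) \<le> C * norm \<tau>"
    using holomorphic_sv_derivative_lipschitz [OF U h' lin] by blast
  have "\<forall>\<^sub>F t in at 0. norm (h' (v + t *\<^sub>R e) d - h' v d) \<le> C * \<bar>t\<bar>"
    unfolding eventually_at
  proof (intro exI conjI ballI impI)
    fix t :: real assume "t \<noteq> 0 \<and> dist t 0 < \<delta>"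
    then show "norm (h' (v + t *\<^sub>R e) d - h' v d) \<le> C * \<bar>t\<bar>"
      using \<delta>(2) [of "of_real t"] by (simp add: scaleR_eq_smult)
  qed (rule \<delta>(1))
  then have 1: "vanishes_linearly (\<lambda>t. h' (v + t *\<^sub>R e) d - h' v d)"
    by (auto simp: vanishes_linearly_def)
  define q where "q k t = Im ((v + t *\<^sub>R e) $ k) / Y_fun (sym_mat (v + t *\<^sub>R e))" for k t
  have q: "q k differentiable (at 0)" for k
  proof -
    have "\<exists>D. (q k has_real_derivative D) (at 0)"
      unfolding q_def Im_line using Y
      by (intro exI) (auto intro!: derivative_eq_intros has_real_derivative_Y_line)
    then show ?thesis
      using real_differentiable_def by blast
  qed
  have "dlog_Y u d = (of_real (Im (u $ 2) / Y_fun (sym_mat u)) * d $ 1 + of_real (Im (u $ 1) / Y_fun (sym_mat u)) * d $ 2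
      - of_real (Im (u $ 3) / Y_fun (sym_mat u)) * (2 * d $ 3)) * inverse (2 * \<i>)" for u
    by (cases "Y_fun (sym_mat u) = 0") (simp_all add: dlog_Y_def field_simps)
  then have dl: "dlog_Y (v + t *\<^sub>R e) d = (of_real (q 2 t) * d $ 1 + of_real (q 1 t) * d $ 2
      - of_real (q 3 t) * (2 * d $ 3)) * inverse (2 * \<i>)" for t
    unfolding q_def by blast
  have "(\<lambda>t. complex_of_real (q k t)) differentiable (at 0)" for k
    using differentiable_chain_at [OF q [of k], of complex_of_real]
      bounded_linear_imp_differentiable [OF bounded_linear_of_real] by (simp add: o_def)
  then have "(\<lambda>t. dlog_Y (v + t *\<^sub>R e) d) differentiable (at 0)"
    unfolding dl by (intro derivative_intros)
  moreover have "(\<lambda>t. h (v + t *\<^sub>R e)) differentiable (at 0)"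
    using has_vector_derivative_compose [of h "h' v" "\<lambda>t. v + t *\<^sub>R e" 0] h' [OF U(2)] has_vector_derivative_line [of v e 0]
    by (auto simp: intro: differentiableI_vector)
  ultimately have "(\<lambda>t. \<gamma> * h (v + t *\<^sub>R e) * dlog_Y (v + t *\<^sub>R e) d) differentiable (at 0)"
    by (intro derivative_intros)
  from vanishes_linearly_diff [OF 1 vanishes_linearly_differentiable [OF this]]
  show ?thesis
    using F by (simp add: moduli_F_term_def algebra_simps)
qed

section \<open>The Kaehler metric and the potential\<close>

lemma dir_deriv_eq:
  assumes "(f has_derivative f') (at p)"
  shows "dir_deriv f v p = f' v"
proof -
  have "((\<lambda>t. f (p + t *\<^sub>R v)) has_vector_derivative f' v) (at 0)"
    using has_vector_derivative_compose [of f f' "\<lambda>t. p + t *\<^sub>R v" 0] assms has_vector_derivative_line [of p v 0]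
    by simp
  then show ?thesis
    unfolding dir_deriv_def by (rule vector_derivative_at)
qed

lemma dir_deriv_cong:
  assumes "\<forall>\<^sub>F t in nhds 0. f (p + t *\<^sub>R v) = g (p + t *\<^sub>R v)"
  shows "dir_deriv f v p = dir_deriv g v p"
proof -
  obtain S where S: "open S" "0 \<in> S" "\<And>t. t \<in> S \<Longrightarrow> f (p + t *\<^sub>R v) = g (p + t *\<^sub>R v)"
    using assms unfolding eventually_nhds by blast
  have "((\<lambda>t. f (p + t *\<^sub>R v)) has_vector_derivative D) (at 0) \<longleftrightarrow>
        ((\<lambda>t. g (p + t *\<^sub>R v)) has_vector_derivative D) (at 0)" for D
    by (rule iffI; erule has_vector_derivative_transform_within_open [OF _ S(1,2)]) (simp_all add: S(3))
  then show ?thesis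
    unfolding dir_deriv_def vector_derivative_def by simp
qed

lemma dir_deriv_cong_open:
  assumes "open U" "p \<in> U" "\<And>q. q \<in> U \<Longrightarrow> f q = g q"
  shows "dir_deriv f v p = dir_deriv g v p"
  using nhds_curve [OF assms(1,2), of v] assms(3) by (intro dir_deriv_cong) (auto elim: eventually_mono)

lemma wirt_cong_open:
  assumes "open U" "p \<in> U" "\<And>q. q \<in> U \<Longrightarrow> f q = g q"
  shows "wirt I f p = wirt I g p" "wirt_bar I f p = wirt_bar I g p"
  unfolding wirt_def wirt_bar_def using dir_deriv_cong_open [OF assms] by simp_all

lemma wirt_eq:
  assumes "(f has_derivative f') (at p)"
  shows "wirt I f p = (f' (axis I 1) - \<i> * f' (axis I \<i>)) / 2"
    and "wirt_bar I f p = (f' (axis I 1) + \<i> * f' (axis I \<i>)) / 2"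
  by (simp_all add: wirt_def wirt_bar_def dir_deriv_eq [OF assms])

definition field_Y :: "complex^4 \<Rightarrow> real" where
  "field_Y p = Im (p $ 2) * Im (p $ 3) - (Im (p $ 4))\<^sup>2"

lemma Y_fun_moduli: "Y_fun (moduli p) = field_Y p"
  by (simp add: moduli_def field_Y_def Y_fun_sym_mat)

definition field_domain :: "(complex^4) set" where
  "field_domain = {p. Re (p $ 1) > 0 \<and> field_Y p > 0}"

lemma open_field_domain: "open field_domain"
  unfolding field_domain_def field_Y_def by (intro open_Collect_conj open_Collect_less continuous_intros)

definition field_dY :: "complex^4 \<Rightarrow> complex^4 \<Rightarrow> real" where
  "field_dY p d = Im (d $ 2) * Im (p $ 3) + Im (p $ 2) * Im (d $ 3) - 2 * Im (p $ 4) * Im (d $ 4)"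

lemma has_derivative_nth: "((\<lambda>p. p $ i) has_derivative (\<lambda>d. d $ i)) (at (p :: complex^'n))"
  by (rule bounded_linear_imp_has_derivative [OF bounded_linear_vec_nth])

lemma has_derivative_field_Y: "(field_Y has_derivative field_dY p) (at p)"
  unfolding field_Y_def [abs_def] field_dY_def [abs_def]
  by (auto intro!: derivative_eq_intros has_derivative_nth simp: fun_eq_iff)

lemma kaehler_potential_eq:
  "kaehler_potential \<gamma> dilaton_kaehler p = - \<gamma> * ln (field_Y p) - ln (2 * Re (p $ 1))"
  by (simp add: kaehler_potential_def dilaton_kaehler_def Y_fun_moduli)

lemma has_derivative_kaehler_potential:
  assumes "p \<in> field_domain"
  shows "((\<lambda>q. complex_of_real (kaehler_potential \<gamma> dilaton_kaehler q)) has_derivative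
     (\<lambda>d. complex_of_real (- \<gamma> * (field_dY p d / field_Y p) - Re (d $ 1) / Re (p $ 1)))) (at p)"
  unfolding kaehler_potential_eq using assms
  by (auto intro!: derivative_eq_intros has_derivative_field_Y has_derivative_nth
      simp: field_domain_def fun_eq_iff field_simps)

text \<open>K depends only on Re S and the imaginary parts of T, U, Z, so its Wirtinger derivatives
  are a real number times 1 in S and times -i or i in the moduli. This is that real number.\<close>

definition K_grad :: "real \<Rightarrow> 4 \<Rightarrow> complex^4 \<Rightarrow> real" where
  "K_grad \<gamma> I p = (if I = 1 then - 1 / (2 * Re (p $ 1)) else
     - \<gamma> / 2 * (if I = 2 then Im (p $ 3) else if I = 3 then Im (p $ 2) else - 2 * Im (p $ 4)) / field_Y p)"

lemma four_cases: "I = 1 \<or> I = 2 \<or> I = 3 \<or> I = (4::4)"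
  using exhaust_4 by blast

lemma wirt_kaehler_potential:
  assumes "p \<in> field_domain"
  shows "wirt I (\<lambda>q. complex_of_real (kaehler_potential \<gamma> dilaton_kaehler q)) p =
      (if I = 1 then 1 else - \<i>) * K_grad \<gamma> I p"
    and "wirt_bar I (\<lambda>q. complex_of_real (kaehler_potential \<gamma> dilaton_kaehler q)) p =
      (if I = 1 then 1 else \<i>) * K_grad \<gamma> I p"
  using assms four_cases [of I] unfolding wirt_eq [OF has_derivative_kaehler_potential [OF assms]]
  by (auto simp: K_grad_def field_dY_def axis_def field_domain_def field_simps)


definition Y_grad :: "4 \<Rightarrow> complex^4 \<Rightarrow> real" where
  "Y_grad I p = (if I = 1 then 0 else if I = 2 then Im (p $ 3) else if I = 3 then Im (p $ 2) else - 2 * Im (p $ 4))"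

lemma has_derivative_K_grad:
  assumes "p \<in> field_domain"
  shows "(K_grad \<gamma> J has_derivative (\<lambda>d. if J = 1 then Re (d $ 1) / (2 * (Re (p $ 1))\<^sup>2) else
     - \<gamma> / 2 * (Y_grad J d / field_Y p - Y_grad J p * field_dY p d / (field_Y p)\<^sup>2))) (at p)"
proof -
  have Y: "field_Y p \<noteq> 0" and x: "Re (p $ 1) \<noteq> 0"
    using assms by (auto simp: field_domain_def)
  \<comment> \<open>The numerators N are real linear in the coordinates, hence each is its own
    derivative.\<close>
  have q: "((\<lambda>q. - \<gamma> / 2 * N q / field_Y q) has_derivative
      (\<lambda>d. - \<gamma> / 2 * (N d / field_Y p - N p * field_dY p d / (field_Y p)\<^sup>2))) (at p)"
    if N: "(N has_derivative N) (at p)" for N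
    using Y by (auto intro!: derivative_eq_intros N has_derivative_field_Y simp: fun_eq_iff field_simps power2_eq_square)
  have n: "((\<lambda>q. Im (q $ i)) has_derivative (\<lambda>q. Im (q $ i))) (at p)"
    "((\<lambda>q. - 2 * Im (q $ i)) has_derivative (\<lambda>q. - 2 * Im (q $ i))) (at p)" for i
    by (auto intro!: derivative_eq_intros has_derivative_nth)
  have "((\<lambda>q. - 1 / (2 * Re (q $ 1))) has_derivative (\<lambda>d. Re (d $ 1) / (2 * (Re (p $ 1))\<^sup>2))) (at p)"
    using x by (auto intro!: derivative_eq_intros has_derivative_nth simp: fun_eq_iff field_simps power2_eq_square)
  then show ?thesis
    using four_cases [of J] q [OF n(1)] q [OF n(2)] unfolding K_grad_def [abs_def] Y_grad_def by auto
qed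

text \<open>In the real variables Re S, Im T, Im U, Im Z the metric is a quarter of the Hessian of
  K, the phases -i and i having product 1. The constants 1 and -2 are the second derivatives of
  Y.\<close>

lemma kaehler_metric_entry:
  assumes p: "p \<in> field_domain"
  shows "kaehler_metric (kaehler_potential \<gamma> dilaton_kaehler) p $ I $ J =
    of_real (if I = 1 \<and> J = 1 then 1 / (2 * Re (p $ 1))\<^sup>2 else
     \<gamma> / 4 * (Y_grad I p * Y_grad J p / (field_Y p)\<^sup>2 -
       (if (I, J) \<in> {(2, 3), (3, 2)} then 1 else if (I, J) = (4, 4) then - 2 else 0) / field_Y p))"
proof -
  define c where "c = (if J = 1 then 1 else \<i>)"
  define g where "g d = (if J = 1 then Re (d $ 1) / (2 * (Re (p $ 1))\<^sup>2) else
     - \<gamma> / 2 * (Y_grad J d / field_Y p - Y_grad J p * field_dY p d / (field_Y p)\<^sup>2))" for d :: "complex^4"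
  have Y: "field_Y p \<noteq> 0" and x: "Re (p $ 1) \<noteq> 0"
    using p by (auto simp: field_domain_def)
  have "((\<lambda>q. c * complex_of_real (K_grad \<gamma> J q)) has_derivative (\<lambda>d. c * complex_of_real (g d))) (at p)"
    using has_derivative_K_grad [OF p, of \<gamma> J, folded g_def]
    by (auto intro!: derivative_eq_intros)
  from wirt_eq(1) [OF this, of I]
  have "wirt I (\<lambda>q. c * complex_of_real (K_grad \<gamma> J q)) p =
      (c * complex_of_real (g (axis I 1)) - \<i> * (c * complex_of_real (g (axis I \<i>)))) / 2" .
  moreover have "kaehler_metric (kaehler_potential \<gamma> dilaton_kaehler) p $ I $ J =
      wirt I (\<lambda>q. c * complex_of_real (K_grad \<gamma> J q)) p"
    unfolding kaehler_metric_def c_def vec_lambda_beta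
    by (rule wirt_cong_open(1) [OF open_field_domain p]) (rule wirt_kaehler_potential(2))
  ultimately show ?thesis
    using four_cases [of I] four_cases [of J] Y x
    by (elim disjE)
       (simp_all add: c_def g_def Y_grad_def field_dY_def axis_def field_simps power2_eq_square)
qed

text \<open>With y = Im M, the moduli block is 4 / \<gamma> times the symmetrised square of y: the
  entry for the index pairs (ij), (kl) is (y_ik y_jl + y_il y_jk) / 2. It is polynomial in y, so its
  continuity is immediate.\<close>

definition inverse_metric :: "real \<Rightarrow> complex^4 \<Rightarrow> 4 \<Rightarrow> 4 \<Rightarrow> real" where
  "inverse_metric \<gamma> p I J = (let x = Re (p $ 1); a = Im (p $ 2); b = Im (p $ 3); c = Im (p $ 4) in
     vector [vector [4 * x\<^sup>2, 0, 0, 0],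
             vector [0, 4 / \<gamma> * a\<^sup>2, 4 / \<gamma> * c\<^sup>2, 4 / \<gamma> * (a * c)],
             vector [0, 4 / \<gamma> * c\<^sup>2, 4 / \<gamma> * b\<^sup>2, 4 / \<gamma> * (b * c)],
             vector [0, 4 / \<gamma> * (a * c), 4 / \<gamma> * (b * c), 4 / \<gamma> * ((a * b + c\<^sup>2) / 2)]] $ I $ J)"

lemma vector_4_nth [simp]:
  "(vector [a, b, c, d] :: 'a::zero^4) $ 1 = a" "(vector [a, b, c, d] :: 'a::zero^4) $ 2 = b"
  "(vector [a, b, c, d] :: 'a::zero^4) $ 3 = c" "(vector [a, b, c, d] :: 'a::zero^4) $ 4 = d"
  by (simp_all add: vector_def)

lemma inverse_kaehler_metric_entry:
  assumes p: "p \<in> field_domain" and "\<gamma> \<noteq> 0"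
  shows "inverse_kaehler_metric (kaehler_potential \<gamma> dilaton_kaehler) p $ I $ J = of_real (inverse_metric \<gamma> p I J)"
proof -
  define A where "A = kaehler_metric (kaehler_potential \<gamma> dilaton_kaehler) p"
  define B :: "complex^4^4" where "B = (\<chi> I J. of_real (inverse_metric \<gamma> p I J))"
  have "field_Y p > 0" and x: "Re (p $ 1) \<noteq> 0"
    using p by (auto simp: field_domain_def)
  have "(\<Sum>K\<in>UNIV. (if I = 1 \<and> K = 1 then 1 / (2 * Re (p $ 1))\<^sup>2 else
     \<gamma> / 4 * (Y_grad I p * Y_grad K p / (field_Y p)\<^sup>2 -
       (if (I, K) \<in> {(2, 3), (3, 2)} then 1 else if (I, K) = (4, 4) then - 2 else 0) / field_Y p)) *
      inverse_metric \<gamma> p K J) = (if I = J then 1 else 0)" for I J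
  proof -
    define a b c Y where abcY: "a = Im (p $ 2)" "b = Im (p $ 3)" "c = Im (p $ 4)" "Y = field_Y p"
    have Y: "Y \<noteq> 0" "Y = a * b - c * c"
      using \<open>field_Y p > 0\<close> by (auto simp: abcY field_Y_def power2_eq_square)
    \<comment> \<open>Writing u for 1 / Y turns each entry of the matrix product into a polynomial
      identity modulo u (a b - c c) = 1.\<close>
    define u where "u = inverse Y"
    have u: "u * (a * b - c * c) = 1"
      using Y by (simp add: u_def)
    have ids:
      "b * (b * a\<^sup>2) / Y\<^sup>2 + (b * a / Y\<^sup>2 - 1 / Y) * c\<^sup>2 - 2 * (a * (b * (c * c))) / Y\<^sup>2 = 1"
      "b * (b * c\<^sup>2) / Y\<^sup>2 + (b * a / Y\<^sup>2 - 1 / Y) * b\<^sup>2 = 2 * (b * (b * (c * c))) / Y\<^sup>2"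
      "b * (b * (a * c)) / Y\<^sup>2 + (b * a / Y\<^sup>2 - 1 / Y) * (b * c) = b * (c * (4 * (a * b) + 4 * c\<^sup>2)) / (Y\<^sup>2 * 4)"
      "(a * b / Y\<^sup>2 - 1 / Y) * a\<^sup>2 + a * (a * c\<^sup>2) / Y\<^sup>2 = 2 * (a * (a * (c * c))) / Y\<^sup>2"
      "- (2 * (b * (c * a\<^sup>2)) / Y\<^sup>2) - 2 * (a * (c * c\<^sup>2)) / Y\<^sup>2 + (4 * (c * c) / Y\<^sup>2 + 2 / Y) * (a * c) = 0"
      "(a * b / Y\<^sup>2 - 1 / Y) * c\<^sup>2 + a * (a * b\<^sup>2) / Y\<^sup>2 - 2 * (a * (b * (c * c))) / Y\<^sup>2 = 1"
      "(a * b / Y\<^sup>2 - 1 / Y) * (a * c) + a * (a * (b * c)) / Y\<^sup>2 = a * (c * (4 * (a * b) + 4 * c\<^sup>2)) / (Y\<^sup>2 * 4)"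
      "- (2 * (b * (c * c\<^sup>2)) / Y\<^sup>2) - 2 * (a * (c * b\<^sup>2)) / Y\<^sup>2 + (4 * (c * c) / Y\<^sup>2 + 2 / Y) * (b * c) = 0"
      "(4 * (c * c) / Y\<^sup>2 + 2 / Y) * (4 * (a * b) + 4 * c\<^sup>2) / 8 - 4 * (a * (b * (c * c))) / Y\<^sup>2 = 1"
      unfolding divide_inverse inverse_mult_distrib power_inverse [symmetric] u_def [symmetric]
      using u by algebra+
    show ?thesis
      using four_cases [of I] four_cases [of J]
      by (elim disjE)
         (simp_all add: sum_4 inverse_metric_def Let_def Y_grad_def x \<open>\<gamma> \<noteq> 0\<close> ids flip: abcY)
  qed
  then have AB: "A ** B = mat 1"
    unfolding A_def B_def vec_eq_iff matrix_matrix_mult_def vec_lambda_beta kaehler_metric_entry [OF p]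
    by (simp add: mat_def flip: of_real_mult of_real_sum)
  then have "B ** A = mat 1"
    by (simp add: matrix_left_right_inverse)
  have "A ** matrix_inv A = mat 1"
    using arg_cong [OF AB, of det] by (intro mult_matrix_inv) (auto simp: det_mul)
  then have "matrix_inv A = B"
    by (metis \<open>B ** A = mat 1\<close> matrix_mul_assoc matrix_mul_lid matrix_mul_rid)
  moreover have "inverse_metric \<gamma> p I J = inverse_metric \<gamma> p J I"
    using four_cases [of I] four_cases [of J] by (elim disjE) (simp_all add: inverse_metric_def Let_def)
  ultimately show ?thesis
    unfolding inverse_kaehler_metric_def A_def [symmetric] by (simp add: transpose_def B_def)
qed

section \<open>Factorisation of the F-terms and of the potential\<close>

lemma vector_3_nth [simp]:
  "(vector [a, b, c] :: 'a::zero^3) $ 1 = a" "(vector [a, b, c] :: 'a::zero^3) $ 2 = b"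
  "(vector [a, b, c] :: 'a::zero^3) $ 3 = c"
  by (rule vector_3)+

definition field_pt :: "complex \<Rightarrow> complex^3 \<Rightarrow> complex^4" where
  "field_pt S v = vector [S, v $ 1, v $ 2, v $ 3]"

definition moduli_part :: "complex^4 \<Rightarrow> complex^3" where
  "moduli_part p = vector [p $ 2, p $ 3, p $ 4]"

lemma field_pt_nth [simp]:
  "field_pt S v $ 1 = S" "field_pt S v $ 2 = v $ 1" "field_pt S v $ 3 = v $ 2" "field_pt S v $ 4 = v $ 3"
  by (simp_all add: field_pt_def)

lemma moduli_part_field_pt [simp]: "moduli_part (field_pt S v) = v"
  by (simp add: moduli_part_def vec_eq_iff forall_3)

lemma moduli_eq: "moduli p = sym_mat (moduli_part p)"
  by (simp add: moduli_def moduli_part_def)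

lemma field_point_sym_mat: "field_point S (sym_mat v) = field_pt S v"
  by (simp add: field_point_def field_pt_def sym_mat_eq_m2)

lemma field_Y_field_pt: "field_Y (field_pt S v) = Y_fun (sym_mat v)"
  by (simp add: field_Y_def Y_fun_sym_mat)

lemma bounded_linear_moduli_part: "bounded_linear moduli_part"
  by (intro linear_conv_bounded_linear [THEN iffD1] linearI)
     (simp_all add: moduli_part_def vec_eq_iff forall_3)

lemma moduli_part_axis:
  "moduli_part (axis 1 c) = 0"
  "moduli_part (axis I \<i>) = \<i> *s moduli_part (axis I 1)"
  by (simp_all add: moduli_part_def axis_def vec_eq_iff forall_3)

lemma has_derivative_superpotential:
  assumes \<Omega>: "(\<Omega> has_field_derivative \<Omega>') (at (p $ 1))"
    and h: "(h has_derivative h') (at (moduli_part p))"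
  shows "((\<lambda>q. \<Omega> (q $ 1) * h (moduli_part q)) has_derivative
     (\<lambda>d. \<Omega> (p $ 1) * h' (moduli_part d) + \<Omega>' * d $ 1 * h (moduli_part p))) (at p)"
proof -
  have "((\<lambda>q. \<Omega> (q $ 1)) has_derivative (\<lambda>d. \<Omega>' * d $ 1)) (at p)"
    using has_derivative_compose [OF has_derivative_nth \<Omega> [unfolded has_field_derivative_def]] .
  moreover have "((\<lambda>q. h (moduli_part q)) has_derivative (\<lambda>d. h' (moduli_part d))) (at p)"
    using has_derivative_compose [OF bounded_linear_imp_has_derivative [OF bounded_linear_moduli_part] h] .
  ultimately show ?thesis
    by (rule has_derivative_mult)
qed

text \<open>For I = 1 the direction is 0 and so is the value, which lets sums run over all four
  field indices.\<close>

definition moduli_F_index ::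
    "real \<Rightarrow> (complex^3 \<Rightarrow> complex) \<Rightarrow> (complex^3 \<Rightarrow> complex^3 \<Rightarrow> complex) \<Rightarrow> 4 \<Rightarrow> complex^3 \<Rightarrow> complex" where
  "moduli_F_index \<gamma> h h' I v = moduli_F_term \<gamma> h h' v (moduli_part (axis I 1))"

lemma F_term_eq:
  fixes h :: "complex^3 \<Rightarrow> complex"
  assumes \<Omega>: "(\<Omega> has_field_derivative \<Omega>') (at S)"
    and h: "(h has_derivative h' v) (at v)" "\<And>c w. h' v (c *s w) = c * h' v w"
    and S: "Re S > 0" and Y: "Y_fun (sym_mat v) > 0"
    and W: "W = (\<lambda>q. \<Omega> (q $ 1) * h (moduli_part q))"
  shows "F_term (kaehler_potential \<gamma> dilaton_kaehler) W I (field_pt S v) =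
    (if I = 1 then h v * (\<Omega>' - \<Omega> S / of_real (2 * Re S)) else \<Omega> S * moduli_F_index \<gamma> h h' I v)"
proof -
  let ?p = "field_pt S v"
  have p: "?p \<in> field_domain"
    using S Y by (simp add: field_domain_def field_Y_field_pt)
  have "(W has_derivative (\<lambda>d. \<Omega> S * h' v (moduli_part d) + \<Omega>' * d $ 1 * h v)) (at ?p)"
    unfolding W using has_derivative_superpotential [of \<Omega> \<Omega>' ?p h "h' v"] \<Omega> h(1) by simp
  note W' = wirt_eq(1) [OF this, of I]
  have aI: "axis I \<i> $ 1 = \<i> * axis I 1 $ 1"
    by (simp add: axis_def)
  have w: "wirt I W ?p = \<Omega> S * h' v (moduli_part (axis I 1)) + \<Omega>' * axis I 1 $ 1 * h v"
    unfolding W' aI moduli_part_axis(2) [of I] h(2) by (simp add: algebra_simps)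
  have Wp: "W ?p = \<Omega> S * h v"
    by (simp add: W)
  have ax: "axis I 1 $ 1 = (if I = 1 then 1 else 0 :: complex)"
    by (simp add: axis_def)
  have h0: "h' v 0 = 0"
    using h(2) [of 0 0] by simp
  have dl: "(if I = 1 then 1 else - \<i>) * complex_of_real (K_grad \<gamma> I ?p) =
      (if I = 1 then - 1 / (2 * Re S) else - \<gamma> * dlog_Y v (moduli_part (axis I 1)))"
    using four_cases [of I] Y
    by (elim disjE) (simp_all add: K_grad_def field_Y_field_pt dlog_Y_def moduli_part_def axis_def field_simps)
  show ?thesis
    unfolding F_term_def w Wp wirt_kaehler_potential(1) [OF p] dl
    by (auto simp: moduli_F_index_def moduli_F_term_def moduli_part_axis(1) h0 ax algebra_simps)
qed

definition dilaton_profile :: "(complex \<Rightarrow> complex) \<Rightarrow> (complex \<Rightarrow> complex) \<Rightarrow> complex \<Rightarrow> real" where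
  "dilaton_profile \<Omega> \<Omega>' S = ((norm (of_real (2 * Re S) * \<Omega>' S - \<Omega> S))\<^sup>2 - 3 * (norm (\<Omega> S))\<^sup>2) / (2 * Re S)"

text \<open>The moduli block of the inverse metric is independent of S, and the index 1 contributes
  nothing, so the base value S = 1 is an arbitrary choice.\<close>

definition moduli_profile ::
    "real \<Rightarrow> (complex^3 \<Rightarrow> complex) \<Rightarrow> (complex^3 \<Rightarrow> complex^3 \<Rightarrow> complex) \<Rightarrow> complex^3 \<Rightarrow> real" where
  "moduli_profile \<gamma> h h' v = (\<Sum>I\<in>UNIV. \<Sum>J\<in>UNIV.
     (exp (- \<gamma> * ln (Y_fun (sym_mat v))) * inverse_metric \<gamma> (field_pt 1 v) I J) *
     Re (moduli_F_index \<gamma> h h' I v * cnj (moduli_F_index \<gamma> h h' J v)))"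

text \<open>With x = 2 Re S, the inverse metric is block diagonal with S-entry x^2, which turns
  |F_S|^2 into |h|^2 |x \<Omega>' - \<Omega>|^2. The term -3 |W|^2 joins this part, and exp K =
  Y^(-\<gamma>) / x distributes over both.\<close>

lemma scalar_potential_eq:
  fixes h :: "complex^3 \<Rightarrow> complex"
  assumes \<Omega>: "(\<Omega> has_field_derivative \<Omega>' S) (at S)"
    and h: "(h has_derivative h' v) (at v)" "\<And>c w. h' v (c *s w) = c * h' v w"
    and S: "Re S > 0" and Y: "Y_fun (sym_mat v) > 0" and \<gamma>: "\<gamma> \<noteq> 0"
    and W: "W = (\<lambda>q. \<Omega> (q $ 1) * h (moduli_part q))"
  shows "scalar_potential (kaehler_potential \<gamma> dilaton_kaehler) W (field_pt S v) =
    dilaton_profile \<Omega> \<Omega>' S * kaehler_norm \<gamma> h v + (norm (\<Omega> S))\<^sup>2 / (2 * Re S) * moduli_profile \<gamma> h h' v"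
proof -
  let ?p = "field_pt S v" and ?E = "exp (- \<gamma> * ln (Y_fun (sym_mat v)))"
  have p: "?p \<in> field_domain"
    using S Y by (simp add: field_domain_def field_Y_field_pt)
  define F where "F I = F_term (kaehler_potential \<gamma> dilaton_kaehler) W I ?p" for I
  define m where "m = inverse_metric \<gamma> ?p"
  define f where "f I = moduli_F_index \<gamma> h h' I v" for I
  note F_eq = F_term_eq [where \<gamma> = \<gamma> and h = h and h' = h' and v = v and S = S and \<Omega> = \<Omega> and \<Omega>' = "\<Omega>' S", OF \<Omega> h S Y W, folded F_def f_def]
  have f1: "f 1 = 0"
    using h(2) [of 0 0] by (simp add: f_def moduli_F_index_def moduli_F_term_def moduli_part_axis(1) dlog_Y_def)
  have K: "exp (kaehler_potential \<gamma> dilaton_kaehler ?p) = ?E / (2 * Re S)"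
    using S by (simp add: kaehler_potential_eq field_Y_field_pt exp_diff)
  have scale: "Re (z * f * cnj (z * g)) = (norm z)\<^sup>2 * Re (f * cnj g)" for z f g :: complex
    unfolding cmod_power2 by (simp add: algebra_simps power2_eq_square)
  have zz: "Re (z * cnj z) = (norm z)\<^sup>2" for z
    by (simp add: complex_mult_cnj cmod_power2 del: times_complex.sel)
  have summand: "m I J * Re (F I * cnj (F J)) =
      (if I = 1 then if J = 1 then 4 * (Re S)\<^sup>2 * (norm (F 1))\<^sup>2 else 0 else 0) +
      (norm (\<Omega> S))\<^sup>2 * (inverse_metric \<gamma> (field_pt 1 v) I J * Re (f I * cnj (f J)))" for I J
  proof (cases "I = 1 \<or> J = 1")
    case True
    then show ?thesis
      using four_cases [of I] four_cases [of J]
      by (elim disjE)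
         (simp_all add: m_def inverse_metric_def Let_def f1 zz del: complex_cnj_mult times_complex.sel)
  next
    case False
    then have "m I J = inverse_metric \<gamma> (field_pt 1 v) I J"
      using four_cases [of I] four_cases [of J]
      by (elim disjE) (simp_all add: m_def inverse_metric_def Let_def)
    with False show ?thesis
      by (simp add: F_eq scale del: complex_cnj_mult times_complex.sel)
  qed
  define T where "T = (\<Sum>I\<in>UNIV. \<Sum>J\<in>UNIV. inverse_metric \<gamma> (field_pt 1 v) I J * Re (f I * cnj (f J)))"
  have F1: "4 * (Re S)\<^sup>2 * (norm (F 1))\<^sup>2 = (norm (h v))\<^sup>2 * (norm (of_real (2 * Re S) * \<Omega>' S - \<Omega> S))\<^sup>2"
  proof -
    have "of_real (2 * Re S) * F 1 = h v * (of_real (2 * Re S) * \<Omega>' S - \<Omega> S)"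
      using S by (simp add: F_eq field_simps)
    from arg_cong [OF this, of "\<lambda>z. (norm z)\<^sup>2"] show ?thesis
      by (simp add: norm_mult power_mult_distrib)
  qed
  have Re_scale: "Re (complex_of_real r * z) = r * Re z" for r z
    by simp
  have "Re (\<Sum>I\<in>UNIV. \<Sum>J\<in>UNIV. complex_of_real (m I J) * F I * cnj (F J)) =
      (\<Sum>I\<in>UNIV. \<Sum>J\<in>UNIV. m I J * Re (F I * cnj (F J)))"
    by (simp only: Re_sum mult.assoc Re_scale)
  also have "\<dots> = 4 * (Re S)\<^sup>2 * (norm (F 1))\<^sup>2 + (norm (\<Omega> S))\<^sup>2 * T"
    unfolding summand sum.distrib sum_distrib_left T_def by (simp add: sum_4)
  finally have sum: "Re (\<Sum>I\<in>UNIV. \<Sum>J\<in>UNIV. complex_of_real (m I J) * F I * cnj (F J)) =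
      (norm (h v))\<^sup>2 * (norm (of_real (2 * Re S) * \<Omega>' S - \<Omega> S))\<^sup>2 + (norm (\<Omega> S))\<^sup>2 * T"
    unfolding F1 .
  have profile: "moduli_profile \<gamma> h h' v = ?E * T"
    unfolding moduli_profile_def T_def sum_distrib_left f_def by (simp only: mult.assoc)
  have Wp: "(norm (W ?p))\<^sup>2 = (norm (\<Omega> S))\<^sup>2 * (norm (h v))\<^sup>2"
    by (simp add: W norm_mult power_mult_distrib)
  have "E / y * (H * n + w * t - 3 * (w * H)) = (n - 3 * w) / y * (E * H) + w / y * (E * t)" for E y H n w t :: real
    by (simp add: divide_inverse algebra_simps)
  then show ?thesis
    unfolding scalar_potential_def inverse_kaehler_metric_entry [OF p \<gamma>] K
      F_def [symmetric] m_def [symmetric] dilaton_profile_def kaehler_norm_def sum profile Wp .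
qed

lemma isCont_inverse_metric_line:
  assumes "\<gamma> \<noteq> 0"
  shows "isCont (\<lambda>t. inverse_metric \<gamma> (field_pt 1 (v + t *\<^sub>R e)) I J) 0"
  using four_cases [of I] four_cases [of J] assms
  by (elim disjE) (simp_all add: inverse_metric_def Let_def continuous_intros)

lemma moduli_profile_stationary:
  fixes h :: "complex^3 \<Rightarrow> complex"
  assumes U: "open U" "v \<in> U"
    and h': "\<And>u. u \<in> U \<Longrightarrow> (h has_derivative h' u) (at u)"
    and lin: "\<And>u c w. u \<in> U \<Longrightarrow> h' u (c *s w) = c * h' u w"
    and Y: "Y_fun (sym_mat v) > 0" and \<gamma>: "\<gamma> \<noteq> 0" and F: "\<And>d. moduli_F_term \<gamma> h h' v d = 0"
  shows "((\<lambda>t. moduli_profile \<gamma> h h' (v + t *\<^sub>R e)) has_real_derivative 0) (at 0)"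
proof -
  have "isCont (\<lambda>t. Y_fun (sym_mat (v + t *\<^sub>R e))) 0"
    using has_real_derivative_Y_line [of v e] Y DERIV_isCont by auto
  then have c: "isCont (\<lambda>t. exp (- \<gamma> * ln (Y_fun (sym_mat (v + t *\<^sub>R e)))) *
      inverse_metric \<gamma> (field_pt 1 (v + t *\<^sub>R e)) I J) 0" for I J
    using Y by (intro continuous_intros isCont_inverse_metric_line \<gamma>) auto
  have "((\<lambda>t. moduli_profile \<gamma> h h' (v + t *\<^sub>R e)) has_real_derivative (\<Sum>I\<in>(UNIV :: 4 set). \<Sum>J\<in>(UNIV :: 4 set). 0)) (at 0)"
    unfolding moduli_profile_def moduli_F_index_def
    by (intro DERIV_sum vanishes_linearly_product_derivative c
        moduli_F_term_vanishes_linearly [OF U h' lin Y F])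
  then show ?thesis
    by simp
qed

section \<open>The dilaton direction\<close>

definition dilaton_F :: "(complex \<Rightarrow> complex) \<Rightarrow> (complex \<Rightarrow> complex) \<Rightarrow> complex \<Rightarrow> complex" where
  "dilaton_F \<Omega> \<Omega>' S = of_real (2 * Re S) * \<Omega>' S - \<Omega> S"

text \<open>The Wirtinger derivative of \<open>dilaton_profile\<close> in S. After substituting
  \<Omega>' = (f + \<Omega>) / x, the terms in |f|^2 and |\<Omega>|^2 cancel against those from
  differentiating 1 / x.\<close>

definition dilaton_grad ::
    "(complex \<Rightarrow> complex) \<Rightarrow> (complex \<Rightarrow> complex) \<Rightarrow> (complex \<Rightarrow> complex) \<Rightarrow> complex \<Rightarrow> complex" where
  "dilaton_grad \<Omega> \<Omega>' \<Omega>'' S =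
     \<Omega>'' S * cnj (dilaton_F \<Omega> \<Omega>' S) - 2 * cnj (\<Omega> S) * dilaton_F \<Omega> \<Omega>' S / of_real ((2 * Re S)\<^sup>2)"

text \<open>Since x = S + cnj S, the S-derivative of x contributes an \<Omega>' that cancels against
  the derivative of -\<Omega>, while its conjugate derivative leaves \<Omega>'.\<close>

lemma has_derivative_dilaton_F:
  assumes "(\<Omega> has_field_derivative \<Omega>' S) (at S)" "(\<Omega>' has_field_derivative \<Omega>'' S) (at S)"
  shows "(dilaton_F \<Omega> \<Omega>' has_derivative (\<lambda>d. of_real (2 * Re S) * \<Omega>'' S * d + \<Omega>' S * cnj d)) (at S)"
proof -
  note D = assms [unfolded has_field_derivative_def]
  have r: "((\<lambda>S. complex_of_real (2 * Re S)) has_derivative (\<lambda>d. of_real (2 * Re d))) (at S)"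
    by (auto intro!: derivative_eq_intros)
  have "d + cnj d = of_real (2 * Re d)" for d
    by (simp add: complex_add_cnj)
  then have c: "cnj d = of_real (2 * Re d) - d" for d
    by (simp add: algebra_simps)
  show ?thesis
    unfolding dilaton_F_def [abs_def] c
    using has_derivative_diff [OF has_derivative_mult [OF r D(2)] D(1)]
    by (rule has_derivative_eq_rhs) (simp add: fun_eq_iff algebra_simps)
qed

lemma has_derivative_norm_power2:
  fixes f :: "'a::real_normed_vector \<Rightarrow> complex"
  assumes "(f has_derivative f') (at x)"
  shows "((\<lambda>x. (norm (f x))\<^sup>2) has_derivative (\<lambda>d. 2 * Re (cnj (f x) * f' d))) (at x)"
proof -
  have "((\<lambda>x. Re (f x)) has_derivative (\<lambda>d. Re (f' d))) (at x)" "((\<lambda>x. Im (f x)) has_derivative (\<lambda>d. Im (f' d))) (at x)"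
    using assms by (auto intro!: derivative_eq_intros)
  from has_derivative_add [OF has_derivative_mult [OF this(1) this(1)] has_derivative_mult [OF this(2) this(2)]]
  show ?thesis
    unfolding cmod_power2 unfolding power2_eq_square
    by (rule has_derivative_eq_rhs) (simp add: fun_eq_iff algebra_simps)
qed

lemma has_derivative_dilaton_profile:
  assumes \<Omega>: "(\<Omega> has_field_derivative \<Omega>' S) (at S)" "(\<Omega>' has_field_derivative \<Omega>'' S) (at S)"
    and S: "Re S > 0"
  shows "(dilaton_profile \<Omega> \<Omega>' has_derivative (\<lambda>d. 2 * Re (dilaton_grad \<Omega> \<Omega>' \<Omega>'' S * d))) (at S)"
proof -
  let ?f = "dilaton_F \<Omega> \<Omega>' S" and ?x = "2 * Re S"
  have x: "((\<lambda>S. 2 * Re S) has_derivative (\<lambda>d. 2 * Re d)) (at S)"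
    by (auto intro!: derivative_eq_intros)
  have x0: "2 * Re S \<noteq> 0"
    using S by simp
  note n = has_derivative_diff [OF has_derivative_norm_power2 [OF has_derivative_dilaton_F [where \<Omega>' = \<Omega>' and \<Omega>'' = \<Omega>'', OF \<Omega>]]
      has_derivative_mult_right [OF has_derivative_norm_power2 [OF \<Omega>(1) [unfolded has_field_derivative_def]], of 3]]
  have \<Omega>': "\<Omega>' S = (?f + \<Omega> S) / of_real ?x"
    using x0 by (simp add: dilaton_F_def field_simps)
  have eq: "((norm ?f)\<^sup>2 - 3 * (norm (\<Omega> S))\<^sup>2) * (- (inverse ?x * (2 * Re d) * inverse ?x)) +
     (2 * Re (cnj ?f * (of_real ?x * \<Omega>'' S * d + \<Omega>' S * cnj d)) - 3 * (2 * Re (cnj (\<Omega> S) * (\<Omega>' S * d)))) * inverse ?x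
     = 2 * Re (dilaton_grad \<Omega> \<Omega>' \<Omega>'' S * d)" for d
  proof -
    define f w w2 x where fw: "f = ?f" "w = \<Omega> S" "w2 = \<Omega>'' S" "x = ?x"
    have "x \<noteq> 0"
      using x0 by (simp add: fw)
    then show ?thesis
      unfolding dilaton_grad_def \<Omega>' fw [symmetric] cmod_power2
      by (simp add: field_simps power2_eq_square)
  qed
  show ?thesis
    unfolding dilaton_profile_def [abs_def] divide_inverse dilaton_F_def [symmetric]
    using has_derivative_mult [OF n Deriv.has_derivative_inverse [OF x0 x]]
    by (rule has_derivative_eq_rhs) (simp only: eq)
qed

text \<open>\<open>q\<close> is the mixed derivative of the profile in S and cnj S, a quarter of its
  Laplacian. It contains \<Omega>'' only through |\<Omega>''|^2, and as f is nonzero the critical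
  equation fixes this modulus: |\<Omega>''| = 2 |\<Omega>| / x^2. Then q = 2 (|\<Omega>|^2 - |f|^2)
  / x^3, and positivity of the profile means |f|^2 > 3 |\<Omega>|^2.\<close>

lemma has_derivative_dilaton_grad:
  assumes \<Omega>: "(\<Omega> has_field_derivative \<Omega>' S) (at S)" "(\<Omega>' has_field_derivative \<Omega>'' S) (at S)"
      "(\<Omega>'' has_field_derivative \<Omega>''' S) (at S)"
    and S: "Re S > 0" and crit: "dilaton_grad \<Omega> \<Omega>' \<Omega>'' S = 0" and pos: "dilaton_profile \<Omega> \<Omega>' S > 0"
  obtains p q where "(dilaton_grad \<Omega> \<Omega>' \<Omega>'' has_derivative (\<lambda>d. p * d + of_real q * cnj d)) (at S)" "q < 0"
proof -
  define f x where "f = dilaton_F \<Omega> \<Omega>' S" and "x = 2 * Re S"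
  have x0: "x > 0"
    using S by (simp add: x_def)
  define p where "p = \<Omega>''' S * cnj f + \<Omega>'' S * cnj (\<Omega>' S) - 2 * cnj (\<Omega> S) * \<Omega>'' S / of_real x + 4 * cnj (\<Omega> S) * f / of_real (x ^ 3)"
  define q where "q = 2 * ((norm (\<Omega> S))\<^sup>2 - (norm f)\<^sup>2) / x ^ 3"
  have \<Omega>': "\<Omega>' S = (f + \<Omega> S) / of_real x"
    using x0 by (simp add: dilaton_F_def f_def x_def field_simps)
  have "(norm f)\<^sup>2 - 3 * (norm (\<Omega> S))\<^sup>2 > 0"
    using pos x0 by (simp add: dilaton_profile_def f_def x_def dilaton_F_def zero_less_divide_iff)
  then have f0: "(norm f)\<^sup>2 > (norm (\<Omega> S))\<^sup>2"
    using zero_le_power2 [of "norm (\<Omega> S)"] by linarith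
  have "\<Omega>'' S * cnj f = 2 * cnj (\<Omega> S) * f / of_real (x\<^sup>2)"
    using crit by (simp add: dilaton_grad_def f_def x_def)
  from arg_cong [OF this, of norm] have "norm (\<Omega>'' S) * norm f = 2 * norm (\<Omega> S) / x\<^sup>2 * norm f"
    using x0 by (simp add: norm_mult norm_divide norm_power)
  moreover have "norm f \<noteq> 0"
    using f0 by auto
  ultimately have w2: "norm (\<Omega>'' S) = 2 * norm (\<Omega> S) / x\<^sup>2"
    using mult_right_cancel by blast
  show thesis
  proof (rule that [of p q])
    show "q < 0"
      unfolding q_def using f0 x0 by (simp add: divide_neg_pos)
    note D = \<Omega> [unfolded has_field_derivative_def]
    have F: "(dilaton_F \<Omega> \<Omega>' has_derivative (\<lambda>d. of_real x * \<Omega>'' S * d + \<Omega>' S * cnj d)) (at S)"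
      using has_derivative_dilaton_F [where \<Omega>' = \<Omega>' and \<Omega>'' = \<Omega>'', OF \<Omega>(1,2)] by (simp only: x_def)
    have c: "((\<lambda>z. cnj (g z)) has_derivative (\<lambda>d. cnj (g' d))) (at S)" if "(g has_derivative g') (at S)" for g g'
      using bounded_linear.has_derivative [OF bounded_linear_cnj that] .
    have r: "((\<lambda>S. complex_of_real (2 * Re S)) has_derivative (\<lambda>d. of_real (2 * Re d))) (at S)"
      by (auto intro!: derivative_eq_intros)
    have i: "((\<lambda>S. inverse (complex_of_real (2 * Re S))) has_derivative
        (\<lambda>d. - (inverse (of_real x) * of_real (2 * Re d) * inverse (of_real x)))) (at S)"
      using Deriv.has_derivative_inverse [OF _ r] x0 by (simp add: x_def)
    have re: "complex_of_real (2 * Re d) = d + cnj d" for d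
      by (simp add: complex_add_cnj)
    have qc: "of_real q = of_real x * \<Omega>'' S * cnj (\<Omega>'' S) - 2 * cnj (\<Omega>' S) * f / of_real (x\<^sup>2)
        - 2 * cnj (\<Omega> S) * \<Omega>' S / of_real (x\<^sup>2) + 4 * cnj (\<Omega> S) * f / of_real (x ^ 3)"
    proof -
      have 1: "\<Omega>'' S * cnj (\<Omega>'' S) = 4 * (\<Omega> S * cnj (\<Omega> S)) / of_real (x ^ 4)"
        unfolding complex_norm_square [symmetric] w2 by (simp add: power_divide power_mult_distrib flip: power_mult)
      have 2: "of_real q = 2 * (\<Omega> S * cnj (\<Omega> S) - f * cnj f) / of_real (x ^ 3)"
        unfolding complex_norm_square [symmetric] q_def by simp
      show ?thesis
        unfolding 2 mult.assoc 1 \<Omega>' using x0 by (simp add: field_simps eval_nat_numeral)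
    qed
    show "(dilaton_grad \<Omega> \<Omega>' \<Omega>'' has_derivative (\<lambda>d. p * d + of_real q * cnj d)) (at S)"
      unfolding dilaton_grad_def [abs_def] divide_inverse power2_eq_square of_real_mult [of "2 * Re _" "2 * Re _"]
        inverse_mult_distrib
      using has_derivative_diff [OF has_derivative_mult [OF D(3) c [OF F]]
          has_derivative_mult [OF has_derivative_mult [OF has_derivative_mult [OF has_derivative_const [of 2] c [OF D(1)]] F]
            has_derivative_mult [OF i i]]]
      by (rule has_derivative_eq_rhs, unfold re qc p_def f_def [symmetric] x_def [symmetric])
         (use x0 in \<open>simp add: fun_eq_iff field_simps eval_nat_numeral\<close>)
  qed
qed

section \<open>From the dilaton block to an eigenvalue of the full Hessian\<close>

lemma negative_eigenvalue_2x2: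
  fixes a b c :: real
  assumes "a + c < 0"
  obtains l x y where "l < 0" "x \<noteq> 0 \<or> y \<noteq> 0" "a * x + b * y = l * x" "b * x + c * y = l * y"
proof (cases "b = 0")
  case True
  from assms consider "a < 0" | "c < 0"
    by linarith
  then show ?thesis
    using that [of a 1 0] that [of c 0 1] True by cases auto
next
  case False
  \<comment> \<open>The gap between the two eigenvalues. The smaller one, l = (a + c - s) / 2, is
    negative with the trace; its eigenvector (b, l - a) is nonzero because b is.\<close>
  define s where "s = sqrt ((a - c)\<^sup>2 + 4 * b\<^sup>2)"
  have "s * s = (a - c)\<^sup>2 + 4 * b\<^sup>2"
    by (simp add: s_def)
  moreover have "s \<ge> 0"
    by (simp add: s_def)
  ultimately show ?thesis
    using assms False
    by (intro that [of "(a + c - s) / 2" b "(c - a - s) / 2"])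
       (auto simp: field_simps power2_eq_square)
qed

lemma dir_deriv_eventually:
  assumes "(\<phi> has_vector_derivative D) (at 0)" "\<forall>\<^sub>F t in nhds 0. f (p + t *\<^sub>R v) = \<phi> t"
  shows "dir_deriv f v p = D"
proof -
  obtain S where S: "open S" "0 \<in> S" "\<And>t. t \<in> S \<Longrightarrow> f (p + t *\<^sub>R v) = \<phi> t"
    using assms(2) unfolding eventually_nhds by blast
  have "((\<lambda>t. f (p + t *\<^sub>R v)) has_vector_derivative D) (at 0)"
    by (rule has_vector_derivative_transform_within_open [OF assms(1) S(1,2)]) (simp add: S(3))
  then show ?thesis
    unfolding dir_deriv_def by (rule vector_derivative_at)
qed

lemma field_pt_line_dilaton: "field_pt S v + t *\<^sub>R axis 1 c = field_pt (S + t *\<^sub>R c) v"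
  using four_cases by (auto simp: vec_eq_iff forall_4 axis_def)

lemma field_pt_line_moduli: "J \<noteq> 1 \<Longrightarrow> field_pt S v + t *\<^sub>R axis J c = field_pt S (v + t *\<^sub>R moduli_part (axis J c))"
  by (auto simp: vec_eq_iff forall_4 axis_def moduli_part_def)

lemma has_vector_derivative_along_line:
  assumes "(f has_derivative f') (at p)"
  shows "((\<lambda>t. f (p + t *\<^sub>R v)) has_vector_derivative f' v) (at 0)"
  using has_vector_derivative_compose [of f f' "\<lambda>t. p + t *\<^sub>R v" 0 v] assms has_vector_derivative_line [of p v 0]
  by simp

text \<open>Stationarity of A and B is asked only along real lines through \<open>v\<^sub>0\<close>,
  because an entry in an S-column of the Hessian involves at most one moduli derivative.
  \<open>B0\<close> removes w from the S-block, where its second derivative would otherwise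
  appear.\<close>

locale separated_potential =
  fixes V :: "complex^4 \<Rightarrow> real" and a w :: "complex \<Rightarrow> real" and A B :: "complex^3 \<Rightarrow> real"
    and g :: "complex \<Rightarrow> complex" and w' :: "complex \<Rightarrow> complex \<Rightarrow> real"
    and \<D> :: "complex set" and U :: "(complex^3) set" and S\<^sub>0 :: complex and v\<^sub>0 :: "complex^3"
  assumes \<D>: "open \<D>" "S\<^sub>0 \<in> \<D>" and U: "open U" "v\<^sub>0 \<in> U"
    and V: "\<And>S v. S \<in> \<D> \<Longrightarrow> v \<in> U \<Longrightarrow> V (field_pt S v) = a S * A v + w S * B v"
    and a: "\<And>S. S \<in> \<D> \<Longrightarrow> (a has_derivative (\<lambda>d. 2 * Re (g S * d))) (at S)"
    and w: "\<And>S. S \<in> \<D> \<Longrightarrow> (w has_derivative w' S) (at S)"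
    and A: "\<And>e. ((\<lambda>t. A (v\<^sub>0 + t *\<^sub>R e)) has_real_derivative 0) (at 0)"
    and B: "\<And>e. ((\<lambda>t. B (v\<^sub>0 + t *\<^sub>R e)) has_real_derivative 0) (at 0)"
    and B0: "B v\<^sub>0 = 0"
begin

lemma dilaton_derivative:
  assumes "S \<in> \<D>" "v \<in> U"
  shows "dir_deriv V (axis 1 c) (field_pt S v) = 2 * Re (g S * c) * A v + w' S c * B v"
proof (rule dir_deriv_eventually)
  have "((\<lambda>t. a (S + t *\<^sub>R c)) has_vector_derivative 2 * Re (g S * c)) (at 0)"
    by (rule has_vector_derivative_along_line [OF a [OF assms(1)]])
  moreover have "((\<lambda>t. w (S + t *\<^sub>R c)) has_vector_derivative w' S c) (at 0)"
    by (rule has_vector_derivative_along_line [OF w [OF assms(1)]])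
  ultimately show "((\<lambda>t. a (S + t *\<^sub>R c) * A v + w (S + t *\<^sub>R c) * B v) has_vector_derivative
      2 * Re (g S * c) * A v + w' S c * B v) (at 0)"
    by (intro has_vector_derivative_add has_vector_derivative_mult_left)
  show "\<forall>\<^sub>F t in nhds 0. V (field_pt S v + t *\<^sub>R axis 1 c) = a (S + t *\<^sub>R c) * A v + w (S + t *\<^sub>R c) * B v"
    using nhds_curve [OF \<D>(1) assms(1), of c] assms(2)
    by (auto elim!: eventually_mono simp: field_pt_line_dilaton V)
qed

lemma wirt_dilaton:
  "wirt 1 (\<lambda>p. complex_of_real (V p)) (field_pt S\<^sub>0 v\<^sub>0) = g S\<^sub>0 * A v\<^sub>0"
proof -
  have "dir_deriv (\<lambda>p. complex_of_real (V p)) (axis 1 c) (field_pt S\<^sub>0 v\<^sub>0) = of_real (2 * Re (g S\<^sub>0 * c) * A v\<^sub>0)" for c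
  proof (rule dir_deriv_eventually)
    have "((\<lambda>t. a (S\<^sub>0 + t *\<^sub>R c)) has_vector_derivative 2 * Re (g S\<^sub>0 * c)) (at 0)"
      by (rule has_vector_derivative_along_line [OF a [OF \<D>(2)]])
    then show "((\<lambda>t. complex_of_real (a (S\<^sub>0 + t *\<^sub>R c) * A v\<^sub>0)) has_vector_derivative
        of_real (2 * Re (g S\<^sub>0 * c) * A v\<^sub>0)) (at 0)"
      by (intro has_vector_derivative_of_real has_real_derivative_iff_has_vector_derivative [THEN iffD2]
          has_vector_derivative_mult_left)
    show "\<forall>\<^sub>F t in nhds 0. complex_of_real (V (field_pt S\<^sub>0 v\<^sub>0 + t *\<^sub>R axis 1 c)) = of_real (a (S\<^sub>0 + t *\<^sub>R c) * A v\<^sub>0)"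
      using nhds_curve [OF \<D>, of c] U(2)
      by (auto elim!: eventually_mono simp: field_pt_line_dilaton V B0)
  qed
  then show ?thesis
    by (simp add: wirt_def complex_eq_iff)
qed

lemma hessian_dilaton_dilaton:
  assumes "(g has_derivative g') (at S\<^sub>0)"
  shows "dir_deriv (dir_deriv V (axis 1 c)) (axis 1 c') (field_pt S\<^sub>0 v\<^sub>0) = 2 * Re (g' c' * c) * A v\<^sub>0"
proof (rule dir_deriv_eventually)
  have "((\<lambda>t. g (S\<^sub>0 + t *\<^sub>R c') * c) has_vector_derivative g' c' * c) (at 0)"
    by (intro has_vector_derivative_mult_left has_vector_derivative_along_line [OF assms])
  from bounded_linear.has_vector_derivative [OF bounded_linear_Re this]
  show "((\<lambda>t. 2 * Re (g (S\<^sub>0 + t *\<^sub>R c') * c) * A v\<^sub>0) has_vector_derivative 2 * Re (g' c' * c) * A v\<^sub>0) (at 0)"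
    by (intro has_vector_derivative_mult_left has_vector_derivative_mult_right)
  show "\<forall>\<^sub>F t in nhds 0. dir_deriv V (axis 1 c) (field_pt S\<^sub>0 v\<^sub>0 + t *\<^sub>R axis 1 c') = 2 * Re (g (S\<^sub>0 + t *\<^sub>R c') * c) * A v\<^sub>0"
    using nhds_curve [OF \<D>, of c'] U(2)
    by (auto elim!: eventually_mono simp: field_pt_line_dilaton dilaton_derivative B0)
qed

lemma hessian_dilaton_moduli:
  assumes "J \<noteq> 1"
  shows "dir_deriv (dir_deriv V (axis 1 c)) (axis J c') (field_pt S\<^sub>0 v\<^sub>0) = 0"
proof (rule dir_deriv_eventually)
  let ?e = "moduli_part (axis J c')"
  have "((\<lambda>t. 2 * Re (g S\<^sub>0 * c) * A (v\<^sub>0 + t *\<^sub>R ?e) + w' S\<^sub>0 c * B (v\<^sub>0 + t *\<^sub>R ?e)) has_real_derivative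
      2 * Re (g S\<^sub>0 * c) * 0 + w' S\<^sub>0 c * 0) (at 0)"
    by (intro DERIV_add DERIV_cmult A B)
  then show "((\<lambda>t. 2 * Re (g S\<^sub>0 * c) * A (v\<^sub>0 + t *\<^sub>R ?e) + w' S\<^sub>0 c * B (v\<^sub>0 + t *\<^sub>R ?e)) has_vector_derivative 0) (at 0)"
    by (simp add: has_real_derivative_iff_has_vector_derivative)
  show "\<forall>\<^sub>F t in nhds 0. dir_deriv V (axis 1 c) (field_pt S\<^sub>0 v\<^sub>0 + t *\<^sub>R axis J c') =
      2 * Re (g S\<^sub>0 * c) * A (v\<^sub>0 + t *\<^sub>R ?e) + w' S\<^sub>0 c * B (v\<^sub>0 + t *\<^sub>R ?e)"
    using nhds_curve [OF U, of ?e] \<D>(2)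
    by (auto elim!: eventually_mono simp: field_pt_line_moduli [OF assms] dilaton_derivative)
qed

lemma negative_hessian_eigenvalue:
  assumes g': "(g has_derivative (\<lambda>d. p * d + of_real q * cnj d)) (at S\<^sub>0)" and q: "q < 0" and A0: "A v\<^sub>0 > 0"
  shows "\<exists>l<0. mat_eigenvalue (real_hessian V (field_pt S\<^sub>0 v\<^sub>0)) l"
proof -
  let ?H = "real_hessian V (field_pt S\<^sub>0 v\<^sub>0)"
  have H: "?H $ a $ b = dir_deriv (dir_deriv V (real_dir b)) (real_dir a) (field_pt S\<^sub>0 v\<^sub>0)" for a b
    by (simp add: real_hessian_def)
  have r: "real_dir (Inl I) = axis I 1" "real_dir (Inr I) = axis I \<i>" for I :: 4
    by (simp_all add: real_dir_def)
  have SS: "?H $ Inl 1 $ Inl 1 = 2 * A v\<^sub>0 * (q + Re p)" "?H $ Inl 1 $ Inr 1 = - 2 * A v\<^sub>0 * Im p"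
    "?H $ Inr 1 $ Inl 1 = - 2 * A v\<^sub>0 * Im p" "?H $ Inr 1 $ Inr 1 = 2 * A v\<^sub>0 * (q - Re p)"
    unfolding H r hessian_dilaton_dilaton [OF g'] by (simp_all add: algebra_simps)
  have MS: "J \<noteq> 1 \<Longrightarrow> ?H $ Inl J $ Inl 1 = 0" "J \<noteq> 1 \<Longrightarrow> ?H $ Inl J $ Inr 1 = 0"
    "J \<noteq> 1 \<Longrightarrow> ?H $ Inr J $ Inl 1 = 0" "J \<noteq> 1 \<Longrightarrow> ?H $ Inr J $ Inr 1 = 0" for J
    unfolding H r by (simp_all add: hessian_dilaton_moduli)
  \<comment> \<open>The pure second derivative p cancels in the trace, leaving 4 q A.\<close>
  have "2 * A v\<^sub>0 * (q + Re p) + 2 * A v\<^sub>0 * (q - Re p) < 0"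
    using mult_pos_neg [OF A0 q] by (simp add: algebra_simps)
  then obtain l x y where l: "l < 0" "x \<noteq> 0 \<or> y \<noteq> 0"
    "2 * A v\<^sub>0 * (q + Re p) * x + (- 2 * A v\<^sub>0 * Im p) * y = l * x"
    "(- 2 * A v\<^sub>0 * Im p) * x + 2 * A v\<^sub>0 * (q - Re p) * y = l * y"
    by (rule negative_eigenvalue_2x2)
  define u :: "real^(4 + 4)" where
    "u = (\<chi> k. case k of Inl I \<Rightarrow> if I = 1 then x else 0 | Inr I \<Rightarrow> if I = 1 then y else 0)"
  \<comment> \<open>Only the two S-columns of the Hessian enter, so its symmetry plays no part in
    the eigenvector equation.\<close>
  have Hu: "(?H *v u) $ k = ?H $ k $ Inl 1 * x + ?H $ k $ Inr 1 * y" for k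
    by (simp add: matrix_vector_mult_def sum_UNIV_Plus u_def sum_4)
  have "?H *v u = l *s u"
  proof (rule vec_eq_iff [THEN iffD2], rule allI)
    fix k :: "4 + 4"
    show "(?H *v u) $ k = (l *s u) $ k"
      unfolding Hu using l(3,4) by (cases k) (auto simp: SS MS u_def)
  qed
  moreover have "u \<noteq> 0"
  proof -
    have "u $ Inl 1 \<noteq> 0 \<or> u $ Inr 1 \<noteq> 0"
      using l(2) by (simp add: u_def)
    then show ?thesis
      by auto
  qed
  ultimately show ?thesis
    using l(1) unfolding mat_eigenvalue_def by blast
qed

end

section \<open>The half-space, the chosen branch and the final contradiction\<close>

lemma siegel_H2_Y_pos:
  assumes "sym_mat v \<in> siegel_H2"
  shows "Y_fun (sym_mat v) > 0"
proof -
  have pos: "x \<bullet> (Im_mat (sym_mat v) *v x) > 0" if "x \<noteq> 0" for x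
    using assms that by (simp add: siegel_H2_def)
  have q: "vector [a, b] \<bullet> (Im_mat (sym_mat v) *v vector [a, b]) =
      a\<^sup>2 * Im (v $ 1) + 2 * (a * b) * Im (v $ 3) + b\<^sup>2 * Im (v $ 2)" for a b
    by (simp add: inner_vec_def matrix_vector_mult_def Im_mat_def sum_2 sym_mat_eq_m2 power2_eq_square algebra_simps)
  have "vector [0, 1] \<noteq> (0 :: real^2)"
    by (auto simp: vec_eq_iff forall_2)
  from pos [OF this] have y2: "Im (v $ 2) > 0"
    unfolding q by simp
  \<comment> \<open>The first row of the adjugate of Im M, on which the quadratic form takes the
    value Im U times Y.\<close>
  then have "vector [Im (v $ 2), - Im (v $ 3)] \<noteq> (0 :: real^2)"
    by (auto simp: vec_eq_iff forall_2)
  from pos [OF this] have "0 < Im (v $ 2) * (Im (v $ 1) * Im (v $ 2) - (Im (v $ 3))\<^sup>2)"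
    unfolding q by (simp add: power2_eq_square algebra_simps)
  then show ?thesis
    using y2 by (simp add: Y_fun_sym_mat zero_less_mult_iff)
qed

lemma siegel_H2_sym_mat:
  assumes "M \<in> siegel_H2"
  obtains v where "M = sym_mat v"
proof
  have "transpose M = M"
    using assms by (simp add: siegel_H2_def)
  from arg_cong [OF this, of "\<lambda>A. A $ 1 $ 2"] have "M $ 2 $ 1 = M $ 1 $ 2"
    by (simp add: transpose_def)
  then show "M = sym_mat (vector [M $ 1 $ 1, M $ 2 $ 2, M $ 1 $ 2])"
    by (simp add: sym_mat_eq_m2 vec_eq_iff forall_2)
qed

lemma holomorphic_sv_onE:
  assumes "holomorphic_sv_on f A"
  obtains f' where "open A" "\<And>x. x \<in> A \<Longrightarrow> (f has_derivative f' x) (at x)"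
    "\<And>x c v. x \<in> A \<Longrightarrow> f' x (c *s v) = c * f' x v"
  using assms unfolding holomorphic_sv_on_def by metis

lemma has_derivative_exp_complex:
  fixes f :: "'a::real_normed_vector \<Rightarrow> complex"
  assumes "(f has_derivative f') (at x)"
  shows "((\<lambda>x. exp (f x)) has_derivative (\<lambda>d. exp (f x) * f' d)) (at x)"
  using has_derivative_compose [OF assms DERIV_exp [unfolded has_field_derivative_def]] .

theorem theorem4p5:
  fixes \<gamma> \<alpha> :: real and \<beta> :: int
    and \<Omega> :: "complex \<Rightarrow> complex" and \<D> :: "complex set"
    and H chi X :: "complex^2^2 \<Rightarrow> complex" and P N :: "(complex^2^2) set"
    and S\<^sub>0 :: complex and M\<^sub>0 :: "complex^2^2"
    and V :: "complex^4 \<Rightarrow> real"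
  assumes "\<gamma> \<noteq> 0" and "\<alpha> * of_int \<beta> = \<gamma>"
    and "open \<D>" and "\<D> \<subseteq> {S. Re S > 0}" and "\<Omega> holomorphic_on \<D>" and "S\<^sub>0 \<in> \<D>"
    and "M\<^sub>0 \<in> {sigma1, sigma2, sigma3, sigma4, sigma5, sigma6}"
    and "siegel_modular_function H P" and "M\<^sub>0 \<in> P"
    and "siegel_cusp_form \<beta> chi" and "chi M\<^sub>0 \<noteq> 0"
    and "power_branch \<alpha> chi N X" and "M\<^sub>0 \<in> N"
    and "V = scalar_potential (kaehler_potential \<gamma> dilaton_kaehler) (superpotential \<Omega> H X)"
  shows "\<not> (V (field_point S\<^sub>0 M\<^sub>0) > 0 \<and>
            wirt 1 (\<lambda>p. complex_of_real (V p)) (field_point S\<^sub>0 M\<^sub>0) = 0 \<and>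
            (\<forall>l. mat_eigenvalue (real_hessian V (field_point S\<^sub>0 M\<^sub>0)) l \<longrightarrow> l \<ge> 0))"
proof
  assume contr: "V (field_point S\<^sub>0 M\<^sub>0) > 0 \<and>
            wirt 1 (\<lambda>p. complex_of_real (V p)) (field_point S\<^sub>0 M\<^sub>0) = 0 \<and>
            (\<forall>l. mat_eigenvalue (real_hessian V (field_point S\<^sub>0 M\<^sub>0)) l \<longrightarrow> l \<ge> 0)"
  note \<gamma> = assms(1) and \<alpha>\<beta> = assms(2) and \<D> = assms(3,6)
  have PH: "P \<subseteq> siegel_H2" and H_hol: "holomorphic_sv_on (H \<circ> sym_mat) (coords P)"
    and H_inv: "\<And>G M. G \<in> Sp4Z \<Longrightarrow> M \<in> P \<Longrightarrow> H (siegel_act G M) = H M"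
    using assms(8) by (auto simp: siegel_modular_function_def meromorphic_sv_on_def)
  have chi_hol: "holomorphic_sv_on (chi \<circ> sym_mat) (coords siegel_H2)"
    and chi_inv: "\<And>G M. G \<in> Sp4Z \<Longrightarrow> M \<in> siegel_H2 \<Longrightarrow>
        chi (siegel_act G M) = det (block_C G ** M + block_D G) powi \<beta> * chi M"
    using assms(10) by (auto simp: siegel_cusp_form_def)
  obtain L where NH: "N \<subseteq> siegel_H2" and L_hol: "holomorphic_sv_on (L \<circ> sym_mat) (coords N)"
    and L: "\<And>M. M \<in> N \<Longrightarrow> exp (L M) = chi M" and X: "\<And>M. M \<in> N \<Longrightarrow> X M = exp (of_real \<alpha> * L M)"
    using assms(12) by (auto simp: power_branch_def)
  have "M\<^sub>0 \<in> siegel_H2"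
    using assms(9) PH by blast
  then obtain v\<^sub>0 where v0: "M\<^sub>0 = sym_mat v\<^sub>0"
    by (rule siegel_H2_sym_mat)
  have Y0: "Y_fun (sym_mat v\<^sub>0) > 0"
    using \<open>M\<^sub>0 \<in> siegel_H2\<close> siegel_H2_Y_pos v0 by blast
  obtain G where G: "regular_fixed_point G (sym_mat v\<^sub>0)"
    using regular_fixed_point_exists [OF assms(7)] v0 by blast
  then have "G \<in> Sp4Z"
    by (simp add: regular_fixed_point_def)
  obtain H' where H': "open (coords P)" "\<And>v. v \<in> coords P \<Longrightarrow> (H \<circ> sym_mat has_derivative H' v) (at v)"
    "\<And>v c w. v \<in> coords P \<Longrightarrow> H' v (c *s w) = c * H' v w"
    using H_hol by (rule holomorphic_sv_onE) blast
  obtain chi' where chi': "open (coords siegel_H2)"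
    "\<And>v. v \<in> coords siegel_H2 \<Longrightarrow> (chi \<circ> sym_mat has_derivative chi' v) (at v)"
    "\<And>v c w. v \<in> coords siegel_H2 \<Longrightarrow> chi' v (c *s w) = c * chi' v w"
    using chi_hol by (rule holomorphic_sv_onE) blast
  obtain L' where L': "open (coords N)" "\<And>v. v \<in> coords N \<Longrightarrow> (L \<circ> sym_mat has_derivative L' v) (at v)"
    "\<And>v c w. v \<in> coords N \<Longrightarrow> L' v (c *s w) = c * L' v w"
    using L_hol by (rule holomorphic_sv_onE) blast
  define U where "U = coords P \<inter> coords N"
  have U: "open U" "v\<^sub>0 \<in> U"
    using H'(1) L'(1) assms(9,13) v0 by (auto simp: U_def coords_def)
  have UH: "v \<in> coords siegel_H2" if "v \<in> U" for v
    using that PH by (auto simp: U_def coords_def)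

  define h where "h v = H (sym_mat v) / X (sym_mat v)" for v
  \<comment> \<open>On U, 1 / X is exp(-\<alpha> L), so the real exponent enters the derivative only
    as the factor -\<alpha> in front of \<open>L'\<close>.\<close>
  define h' where "h' v w = exp (- \<alpha> * L (sym_mat v)) * (H' v w - \<alpha> * H (sym_mat v) * L' v w)" for v w
  have h_exp: "h v = H (sym_mat v) * exp (- \<alpha> * L (sym_mat v))" if "v \<in> U" for v
    using X [of "sym_mat v"] that by (simp add: h_def U_def coords_def exp_minus divide_inverse)
  have h': "(h has_derivative h' v) (at v)" if "v \<in> U" for v
  proof -
    have v: "v \<in> coords P" "v \<in> coords N"
      using that by (auto simp: U_def)
    note H1 = H'(2) [OF v(1), unfolded o_def] and L1 = L'(2) [OF v(2), unfolded o_def]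
    have "((\<lambda>v. exp (- \<alpha> * L (sym_mat v))) has_derivative
        (\<lambda>d. exp (- \<alpha> * L (sym_mat v)) * (- \<alpha> * L' v d))) (at v)"
      by (rule has_derivative_exp_complex [OF has_derivative_mult_right [OF L1]])
    from has_derivative_mult [OF H1 this]
    have "((\<lambda>v. H (sym_mat v) * exp (- \<alpha> * L (sym_mat v))) has_derivative h' v) (at v)"
      by (rule has_derivative_eq_rhs) (simp add: h'_def fun_eq_iff algebra_simps)
    then show ?thesis
      by (rule has_derivative_transform_within_open [OF _ U(1) that]) (simp add: h_exp)
  qed
  have h'_lin: "h' v (c *s w) = c * h' v w" if "v \<in> U" for v c w
    using that H'(3) L'(3) by (simp add: h'_def U_def algebra_simps)

  have H'0: "H' v\<^sub>0 w = 0" for w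
  proof -
    have "H' v\<^sub>0 w + of_int 0 * H (sym_mat v\<^sub>0) * dlog_Y v\<^sub>0 w = 0"
    proof (rule dlog_automorphic_form_fixed_point [OF G])
      show "H (siegel_act G (sym_mat u)) = det (block_C G ** sym_mat u + block_D G) powi 0 * H (sym_mat u)"
        if "u \<in> coords P" for u
        using that H_inv [OF \<open>G \<in> Sp4Z\<close>, of "sym_mat u"] by (simp add: coords_def)
    qed (use Y0 H' U(2) in \<open>simp_all add: U_def\<close>)
    then show ?thesis
      by simp
  qed
  have L'0: "L' v\<^sub>0 w = - of_int \<beta> * dlog_Y v\<^sub>0 w" for w
  proof -
    have "chi' v\<^sub>0 w + of_int \<beta> * chi (sym_mat v\<^sub>0) * dlog_Y v\<^sub>0 w = 0"
    proof (rule dlog_automorphic_form_fixed_point [OF G])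
      show "chi (siegel_act G (sym_mat u)) = det (block_C G ** sym_mat u + block_D G) powi \<beta> * chi (sym_mat u)"
        if "u \<in> coords siegel_H2" for u
        using that chi_inv [OF \<open>G \<in> Sp4Z\<close>, of "sym_mat u"] by (simp add: coords_def)
    qed (use Y0 chi' UH [OF U(2)] assms(11) v0 in simp_all)
    moreover have "chi' v\<^sub>0 w = chi (sym_mat v\<^sub>0) * L' v\<^sub>0 w"
    proof -
      have "(L \<circ> sym_mat has_derivative L' v\<^sub>0) (at v\<^sub>0)"
        using L'(2) U(2) by (simp add: U_def)
      from has_derivative_exp_complex [OF this]
      have "(chi \<circ> sym_mat has_derivative (\<lambda>d. exp ((L \<circ> sym_mat) v\<^sub>0) * L' v\<^sub>0 d)) (at v\<^sub>0)"
        by (rule has_derivative_transform_within_open [OF _ U]) (simp add: L U_def coords_def)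
      from fun_cong [OF has_derivative_unique [OF this chi'(2) [OF UH [OF U(2)]]], of w] show ?thesis
        using L [of "sym_mat v\<^sub>0"] assms(13) v0 by simp
    qed
    ultimately have "chi (sym_mat v\<^sub>0) * (L' v\<^sub>0 w + of_int \<beta> * dlog_Y v\<^sub>0 w) = 0"
      by (simp add: algebra_simps)
    then show ?thesis
      using assms(11) v0 by (simp add: eq_neg_iff_add_eq_0)
  qed
  have "complex_of_real \<gamma> = of_real \<alpha> * of_int \<beta>"
    unfolding \<alpha>\<beta> [symmetric] by simp
  \<comment> \<open>With dH = 0 and d log chi = -\<beta> dlog_Y, the logarithmic derivative of 1 / X
    is \<alpha> \<beta> dlog_Y. The relation \<alpha> \<beta> = \<gamma> makes it cancel the
    connection term of K.\<close>
  then have h'0: "h' v\<^sub>0 w = \<gamma> * h v\<^sub>0 * dlog_Y v\<^sub>0 w" for w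
    unfolding h'_def h_exp [OF U(2)] H'0 L'0 by (simp add: algebra_simps)
  then have F0: "moduli_F_term \<gamma> h h' v\<^sub>0 w = 0" for w
    by (simp add: moduli_F_term_def)

  define \<Omega>' where "\<Omega>' = deriv \<Omega>"
  define \<Omega>'' where "\<Omega>'' = deriv \<Omega>'"
  define \<Omega>''' where "\<Omega>''' = deriv \<Omega>''"
  have hol: "\<Omega>' holomorphic_on \<D>" "\<Omega>'' holomorphic_on \<D>"
    using assms(3,5) by (auto simp: \<Omega>'_def \<Omega>''_def intro!: holomorphic_deriv)
  have D: "(\<Omega> has_field_derivative \<Omega>' S) (at S)" "(\<Omega>' has_field_derivative \<Omega>'' S) (at S)"
      "(\<Omega>'' has_field_derivative \<Omega>''' S) (at S)" if "S \<in> \<D>" for S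
    using that assms(3,5) hol unfolding \<Omega>'_def \<Omega>''_def \<Omega>'''_def by (auto intro: holomorphic_derivI)
  have ReS: "Re S > 0" if "S \<in> \<D>" for S
    using that assms(4) by blast

  have W: "superpotential \<Omega> H X = (\<lambda>q. \<Omega> (q $ 1) * h (moduli_part q))"
    by (simp add: fun_eq_iff superpotential_def moduli_eq h_def)
  have w: "\<exists>w'. ((\<lambda>S. (norm (\<Omega> S))\<^sup>2 / (2 * Re S)) has_derivative w') (at S)" if "S \<in> \<D>" for S
  proof -
    have "((\<lambda>S. 2 * Re S) has_derivative (\<lambda>d. 2 * Re d)) (at S)"
      by (auto intro!: derivative_eq_intros)
    from has_derivative_divide [OF has_derivative_norm_power2 [OF D(1) [OF that, unfolded has_field_derivative_def]] this]
    show ?thesis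
      using ReS [OF that] by auto
  qed
  then obtain w' where w': "\<And>S. S \<in> \<D> \<Longrightarrow> ((\<lambda>S. (norm (\<Omega> S))\<^sup>2 / (2 * Re S)) has_derivative w' S) (at S)"
    by metis
  interpret separated_potential V "dilaton_profile \<Omega> \<Omega>'" "\<lambda>S. (norm (\<Omega> S))\<^sup>2 / (2 * Re S)"
    "kaehler_norm \<gamma> h" "moduli_profile \<gamma> h h'" "dilaton_grad \<Omega> \<Omega>' \<Omega>''" w' \<D> U S\<^sub>0 v\<^sub>0
  proof
    show "V (field_pt S v) = dilaton_profile \<Omega> \<Omega>' S * kaehler_norm \<gamma> h v +
        (norm (\<Omega> S))\<^sup>2 / (2 * Re S) * moduli_profile \<gamma> h h' v" if "S \<in> \<D>" "v \<in> U" for S v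
      unfolding assms(14)
      by (rule scalar_potential_eq [where h = h and h' = h' and v = v and S = S and \<Omega> = \<Omega> and \<Omega>' = \<Omega>', OF D(1) [OF that(1)] h' [OF that(2)] h'_lin [OF that(2)] ReS [OF that(1)] _ \<gamma> W])
         (use siegel_H2_Y_pos UH [OF that(2)] in \<open>simp add: coords_def\<close>)
    show "((\<lambda>t. kaehler_norm \<gamma> h (v\<^sub>0 + t *\<^sub>R e)) has_real_derivative 0) (at 0)" for e
      by (rule kaehler_norm_stationary [OF Y0 h' [OF U(2)] h'0])
    show "((\<lambda>t. moduli_profile \<gamma> h h' (v\<^sub>0 + t *\<^sub>R e)) has_real_derivative 0) (at 0)" for e
      by (rule moduli_profile_stationary [where h = h and h' = h', OF U h' h'_lin Y0 \<gamma> F0])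
    show "moduli_profile \<gamma> h h' v\<^sub>0 = 0"
      by (simp add: moduli_profile_def moduli_F_index_def F0)
    show "(dilaton_profile \<Omega> \<Omega>' has_derivative (\<lambda>d. 2 * Re (dilaton_grad \<Omega> \<Omega>' \<Omega>'' S * d))) (at S)"
      if "S \<in> \<D>" for S
      using D(1,2) [OF that] ReS [OF that] by (rule has_derivative_dilaton_profile)
  qed (use \<D> U w' in auto)
  have pt: "field_point S\<^sub>0 M\<^sub>0 = field_pt S\<^sub>0 v\<^sub>0"
    by (simp add: v0 field_point_sym_mat)
  have "kaehler_norm \<gamma> h v\<^sub>0 \<ge> 0"
    by (simp add: kaehler_norm_def)
  \<comment> \<open>At \<open>v\<^sub>0\<close> the B-term vanishes, so V is the product of the
    profile and the norm. The norm is nonnegative, hence V > 0 makes both factors positive, and the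
    norm can be divided out of the critical equation.\<close>
  moreover have "dilaton_profile \<Omega> \<Omega>' S\<^sub>0 * kaehler_norm \<gamma> h v\<^sub>0 > 0"
    using contr V [OF \<D>(2) U(2)] B0 by (simp add: pt)
  ultimately have pos: "kaehler_norm \<gamma> h v\<^sub>0 > 0" "dilaton_profile \<Omega> \<Omega>' S\<^sub>0 > 0"
    by (auto simp: zero_less_mult_iff)
  have "dilaton_grad \<Omega> \<Omega>' \<Omega>'' S\<^sub>0 = 0"
    using contr pos(1) wirt_dilaton by (simp add: pt)
  from has_derivative_dilaton_grad [where \<Omega> = \<Omega> and \<Omega>' = \<Omega>' and \<Omega>'' = \<Omega>'' and \<Omega>''' = \<Omega>''', OF D [OF \<D>(2)] ReS [OF \<D>(2)] this pos(2)]
  obtain p q where "(dilaton_grad \<Omega> \<Omega>' \<Omega>'' has_derivative (\<lambda>d. p * d + of_real q * cnj d)) (at S\<^sub>0)" "q < 0"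
    by blast
  from negative_hessian_eigenvalue [OF this pos(1)] show False
    using contr unfolding pt by fastforce
qed

end
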